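(* The chair tiling has chromatic index $4$. (This holds for either of the two choices of vertices (a), (b) described in the context.)
   Context: Chair substitution. The prototile is the L-shaped polygon $C=\overline{[0,2]^2\setminus[1,2]^2}$ (a union of three unit squares). The substitution $\omega$ replaces $C$ by the dissection of $2C=\overline{[0,4]^2\setminus[2,4]^2}$ into four tiles congruent to $C$: the tile $C$; the tile $C+(1,1)$; the tile $\overline{[0,2]\times[2,4]\setminus[1,2]\times[2,3]}$; and the tile $\overline{[2,4]\times[0,2]\setminus[2,3]\times[1,2]}$. It is extended to translates and rotations (by multiples of $90^\circ$) of $C$, and to collections of such tiles, in the obvious covariant way (expand by the factor 2, then dissect each expanded tile). The chair tiling is the fixed point tiling of the plane produced by this substitution. It is regarded as an infinite planar graph whose faces are the tiles, and whose edges are the pieces of tile boundaries between consecutive vertices. Choices of vertices. (a) Every tile has 8 vertices: for the tile $C$ these are $(0,0),(1,0),(2,0),(2,1),(1,1),(1,2),(0,2),(0,1)$, and correspondingly for every translated or rotated tile. (b) Vertices are inserted only where 90 degree edges meet, or equivalently (in the paper's words) only vertices of degree at least 3 are inserted, making the graph a map. The chromatic index is the least number of colours in a proper edge colouring (distinct edges sharing an endpoint get different colours). *)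

theory Defs
  imports "HOL-Analysis.Analysis" "HOL-Library.Extended_Nat"
begin

text \<open>The plane is the type of complex numbers; \<open>cbox (Complex a b) (Complex c d)\<close> is the
  rectangle \<open>[a,c] \<times> [b,d]\<close>.\<close>

definition chair :: "complex set" where
  "chair = closure (cbox (Complex 0 0) (Complex 2 2) - cbox (Complex 1 1) (Complex 2 2))"

text \<open>Rotation by \<open>k\<close> quarter turns about the origin followed by a translation.\<close>

definition motion :: "nat \<Rightarrow> complex \<Rightarrow> complex \<Rightarrow> complex" where
  "motion k t z = \<i> ^ k * z + t"

definition chair_tiles :: "complex set set" where
  "chair_tiles = {motion k t ` chair | k t. True}"

definition chair_dissection :: "complex set set" where
  "chair_dissection =
    {chair,
     (\<lambda>z. z + Complex 1 1) ` chair,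
     closure (cbox (Complex 0 2) (Complex 2 4) - cbox (Complex 1 2) (Complex 2 3)),
     closure (cbox (Complex 2 0) (Complex 4 2) - cbox (Complex 2 1) (Complex 3 2))}"

text \<open>Expanding the tile \<open>motion k t ` chair\<close> by the factor 2 gives \<open>motion k (2 * t)\<close> applied
  to twice the chair. The chair has no rotational symmetry, so a tile determines \<open>t\<close>
  and \<open>k\<close> modulo 4, and the dissection of a tile does not depend on how it is written.\<close>

definition chair_subst :: "complex set set \<Rightarrow> complex set set" where
  "chair_subst \<T> =
    {motion k (2 * t) ` P | k t P. motion k t ` chair \<in> \<T> \<and> P \<in> chair_dissection}"

definition plane_tiling :: "complex set set \<Rightarrow> bool" where
  "plane_tiling \<T> \<longleftrightarrow>
    \<T> \<subseteq> chair_tiles \<and> \<Union>\<T> = UNIV \<and>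
    pairwise (\<lambda>S T. disjnt (interior S) (interior T)) \<T>"

text \<open>The substitution fixes more than one tiling of the plane: around the origin there are either
  four chairs with their outer corners at the origin, or one chair with its reflex corner there and
  a second chair filling that corner (in four rotated positions). All of them
  are covered by the following predicate.\<close>

definition chair_tiling :: "complex set set \<Rightarrow> bool" where
  "chair_tiling \<T> \<longleftrightarrow> plane_tiling \<T> \<and> chair_subst \<T> = \<T>"

section \<open>The graph of a tiling\<close>

definition skeleton :: "complex set set \<Rightarrow> complex set" where
  "skeleton \<T> = (\<Union>T\<in>\<T>. frontier T)"

text \<open>Given a set \<open>V\<close> of vertices, the edges are the pieces into which \<open>V\<close> cuts the tile boundaries.
  An edge is represented by the point set of the piece without its end points, so that two
  parallel edges are still distinct.\<close>

definition tiling_edges :: "complex set set \<Rightarrow> complex set \<Rightarrow> complex set set" where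
  "tiling_edges \<T> V = components (skeleton \<T> - V)"

definition edge_ends :: "complex set \<Rightarrow> complex set \<Rightarrow> complex set" where
  "edge_ends V e = closure e \<inter> V"

text \<open>The points of the tiles of \<open>\<T>\<close> that correspond to the points \<open>P\<close> of the prototile.\<close>

definition marked_points :: "complex set \<Rightarrow> complex set set \<Rightarrow> complex set" where
  "marked_points P \<T> = {motion k t z | k t z. motion k t ` chair \<in> \<T> \<and> z \<in> P}"

definition all_vertices :: "complex set set \<Rightarrow> complex set" where
  "all_vertices = marked_points
    {Complex 0 0, Complex 1 0, Complex 2 0, Complex 2 1,
     Complex 1 1, Complex 1 2, Complex 0 2, Complex 0 1}"

text \<open>The points where edges meet at a right angle, and the points of degree at least 3. These sets
  differ: at the reflex corner of a tile two edges meet at a right angle, but the missing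
  quarter is filled by a single tile, so the degree of this point is 2. Both are used.\<close>

definition corner_vertices :: "complex set set \<Rightarrow> complex set" where
  "corner_vertices = marked_points
    {Complex 0 0, Complex 2 0, Complex 2 1, Complex 1 1, Complex 1 2, Complex 0 2}"

definition branch_vertices :: "complex set set \<Rightarrow> complex set" where
  "branch_vertices \<T> =
    {v \<in> all_vertices \<T>.
      card {e \<in> tiling_edges \<T> (all_vertices \<T>). v \<in> edge_ends (all_vertices \<T>) e} \<ge> 3}"

section \<open>Chromatic index\<close>

definition proper_edge_colouring ::
    "'e set \<Rightarrow> ('e \<Rightarrow> 'v set) \<Rightarrow> ('e \<Rightarrow> nat) \<Rightarrow> bool" where
  "proper_edge_colouring E ends c \<longleftrightarrow>
    (\<forall>e\<in>E. \<forall>f\<in>E. e \<noteq> f \<and> ends e \<inter> ends f \<noteq> {} \<longrightarrow> c e \<noteq> c f)"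

text \<open>The value is \<open>\<infinity>\<close> if no finite number of colours suffices.\<close>

definition chromatic_index :: "'e set \<Rightarrow> ('e \<Rightarrow> 'v set) \<Rightarrow> enat" where
  "chromatic_index E ends =
    Inf {enat n | n. \<exists>c. proper_edge_colouring E ends c \<and> c ` E \<subseteq> {..<n}}"

definition tiling_chromatic_index :: "complex set set \<Rightarrow> complex set \<Rightarrow> enat" where
  "tiling_chromatic_index \<T> V = chromatic_index (tiling_edges \<T> V) (edge_ends V)"

end

(* Every tile of a tiling fixed by the substitution has its reflex corner at a lattice point, so the
   graph consists of unit segments between lattice points. The tile owning a unit cell can be read
   off the tile owning the cell that contains it after scaling by 1/2; this shows how segments meet.
   A colouring of the unit segments that is injective at the vertices and constant at the other
   lattice points is a proper edge colouring; hence four colours suffice once such a colouring is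
   found, and they are needed because there is a vertex of degree 4. With all lattice points as
   vertices the colour is the direction of a segment together with its parity. With the corners as
   vertices the edges are straight and the colour alternates along each line. With the points of
   degree at least 3 as vertices the chains of segments bending at reflex corners get colours
   depending on the position of the bend, and the remaining segments alternate in steps of 2. *)
theory Submission
  imports Defs
begin

text \<open>The delicate choice of vertices is the one by degree: an edge may then turn a corner, so
  its direction no longer decides its colour. What saves the local analysis is parity. Each reflex
  corner is \<open>2 * p\<close> or \<open>2 * p + u\<close>, where \<open>p\<close> is again a
  reflex corner and both coordinates of \<open>u\<close> are odd, so reflex corners have even
  coordinate sum. Of two neighbouring lattice points at most one is therefore a reflex corner, and a
  doubled point with odd halved sum, such as (2, 0), is a crossing of degree 4. Since the owners of
  the cells around a point are determined by the owners of the few cells around its half, a colour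
  rule is verified by a finite case analysis on parities, with no induction over substitution levels
  and no knowledge of which fixed tiling is given. That tiles sit on the lattice is a fact to be
  proved, as they may be translated by arbitrary complex vectors; it has to come from invariance
  under the substitution.\<close>

lemma closed_locally_finite_UN:
  fixes F :: "'i \<Rightarrow> 'a::heine_borel set"
  assumes "\<And>i. i \<in> I \<Longrightarrow> closed (F i)"
    and fin: "\<And>x K. finite {i \<in> I. F i \<inter> cball x K \<noteq> {}}"
  shows "closed (\<Union>i\<in>I. F i)"
proof -
  have "closed ((\<Union>i\<in>I. F i) \<inter> cball x 1)" for x
  proof -
    have "(\<Union>i\<in>I. F i) \<inter> cball x 1 = (\<Union>i\<in>{i \<in> I. F i \<inter> cball x 1 \<noteq> {}}. F i) \<inter> cball x 1"
      by auto
    then show ?thesis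
      using assms by (auto intro!: closed_Int closed_UN)
  qed
  note cl = this
  have "x \<in> (\<Union>i\<in>I. F i)" if x: "x \<in> closure (\<Union>i\<in>I. F i)" for x
  proof -
    have "x \<in> closure ((\<Union>i\<in>I. F i) \<inter> cball x 1)"
      unfolding closure_approachable
    proof (intro allI impI)
      fix e :: real assume "e > 0"
      then have "min e 1 > 0" by simp
      then obtain y where "y \<in> (\<Union>i\<in>I. F i)" "dist y x < min e 1"
        using x unfolding closure_approachable by blast
      then show "\<exists>y\<in>(\<Union>i\<in>I. F i) \<inter> cball x 1. dist y x < e"
        by (intro bexI[of _ y]) (auto simp: dist_commute)
    qed
    then show ?thesis
      using cl[of x] by (simp add: closure_closed)
  qed
  then show ?thesis
    by (intro closure_subset_eq[THEN iffD1] subsetI)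
qed

section \<open>Graphs of unit segments\<close>

definition pt :: "int \<Rightarrow> int \<Rightarrow> complex" where
  "pt m n = Complex (of_int m) (of_int n)"

text \<open>A triple starting with \<open>True\<close> denotes a horizontal segment, named by its left end point; the others
  are vertical and named by their lower end point.\<close>

definition seg :: "bool \<times> int \<times> int \<Rightarrow> complex set" where
  "seg = (\<lambda>(h, m, n). if h
     then {z. Im z = of_int n \<and> of_int m \<le> Re z \<and> Re z \<le> of_int m + 1}
     else {z. Re z = of_int m \<and> of_int n \<le> Im z \<and> Im z \<le> of_int n + 1})"

definition oseg :: "bool \<times> int \<times> int \<Rightarrow> complex set" where
  "oseg = (\<lambda>(h, m, n). if h
     then {z. Im z = of_int n \<and> of_int m < Re z \<and> Re z < of_int m + 1}
     else {z. Re z = of_int m \<and> of_int n < Im z \<and> Im z < of_int n + 1})"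

lemma pt_simps [simp]: "Re (pt m n) = of_int m" "Im (pt m n) = of_int n"
  by (auto simp: pt_def)

lemma pt_eq_iff [simp]: "pt m n = pt m' n' \<longleftrightarrow> m = m' \<and> n = n'"
  by (auto simp: complex_eq_iff)

text \<open>Supplies the local finiteness that makes unions of segments, and later of cells,
  closed.\<close>

lemma finite_near_lattice:
  fixes K :: real
  assumes "\<And>i. i \<in> I \<Longrightarrow> F i \<subseteq> {z. \<bar>Re z - of_int (f i)\<bar> \<le> 1 \<and> \<bar>Im z - of_int (g i)\<bar> \<le> 1}"
    and "\<And>m n. finite {i \<in> I. f i = m \<and> g i = n}"
  shows "finite {i \<in> I. F i \<inter> cball x K \<noteq> {}}"
proof -
  define k where "k = \<lceil>norm x + K + 1\<rceil>"
  have "\<bar>f i\<bar> \<le> k \<and> \<bar>g i\<bar> \<le> k" if "i \<in> I" and z: "z \<in> F i" "z \<in> cball x K" for i z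
  proof -
    have "norm z \<le> norm x + K"
      using z(2) norm_triangle_ineq[of x "z - x"] by (auto simp: dist_norm norm_minus_commute)
    then have "\<bar>Re z\<bar> \<le> norm x + K" "\<bar>Im z\<bar> \<le> norm x + K"
      using abs_Re_le_cmod[of z] abs_Im_le_cmod[of z] by linarith+
    then have "of_int \<bar>f i\<bar> \<le> norm x + K + 1" "of_int \<bar>g i\<bar> \<le> norm x + K + 1"
      using assms(1)[OF that(1)] z(1) by (auto simp: abs_if split: if_splits)
    then show ?thesis unfolding k_def by linarith
  qed
  then have "{i \<in> I. F i \<inter> cball x K \<noteq> {}} \<subseteq> (\<Union>m\<in>{-k..k}. \<Union>n\<in>{-k..k}. {i \<in> I. f i = m \<and> g i = n})"
    by (fastforce simp: abs_le_iff)
  then show ?thesis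
    by (rule finite_subset) (use assms(2) in auto)
qed

lemma closed_UN_seg: "closed (\<Union>s\<in>I. seg s)"
proof (rule closed_locally_finite_UN)
  fix s assume "s \<in> I"
  show "closed (seg s)"
    unfolding seg_def case_prod_beta
    by (auto intro!: closed_Collect_conj closed_Collect_eq closed_Collect_le continuous_intros)
next
  fix x :: complex and K :: real
  show "finite {s \<in> I. seg s \<inter> cball x K \<noteq> {}}"
  proof (rule finite_near_lattice[where f = "\<lambda>s. fst (snd s)" and g = "\<lambda>s. snd (snd s)"])
    fix m n
    have "{s \<in> I. fst (snd s) = m \<and> snd (snd s) = n} \<subseteq> {(True, m, n), (False, m, n)}" by auto
    then show "finite {s \<in> I. fst (snd s) = m \<and> snd (snd s) = n}"
      by (rule finite_subset) simp
  qed (auto simp: seg_def case_prod_beta)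
qed

lemma oseg_subset: "oseg s \<subseteq> seg s"
  by (auto simp: seg_def oseg_def case_prod_beta)

lemma connected_oseg: "connected (oseg s)"
proof (rule convex_connected, cases s)
  fix h m n assume s: "s = (h, m, n)"
  show "convex (oseg s)"
  proof (cases h)
    case True
    have "oseg s = ({z. Im z \<ge> of_int n} \<inter> {z. Im z \<le> of_int n}) \<inter>
        ({z. Re z > of_int m} \<inter> {z. Re z < of_int m + 1})"
      using True by (auto simp: oseg_def s)
    then show ?thesis
      by (simp only:) (intro convex_Int convex_halfspace_Re_gt convex_halfspace_Re_lt
          convex_halfspace_Im_ge convex_halfspace_Im_le)
  next
    case False
    have "oseg s = ({z. Re z \<ge> of_int m} \<inter> {z. Re z \<le> of_int m}) \<inter>
        ({z. Im z > of_int n} \<inter> {z. Im z < of_int n + 1})"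
      using False by (auto simp: oseg_def s)
    then show ?thesis
      by (simp only:) (intro convex_Int convex_halfspace_Re_ge convex_halfspace_Re_le
          convex_halfspace_Im_gt convex_halfspace_Im_lt)
  qed
qed

definition mid :: "bool \<times> int \<times> int \<Rightarrow> complex" where
  "mid = (\<lambda>(h, m, n). if h then pt m n + Complex (1/2) 0 else pt m n + Complex 0 (1/2))"

lemma mid_in_oseg: "mid s \<in> oseg s"
  by (auto simp: mid_def oseg_def case_prod_beta)

lemma seg_cases:
  assumes "z \<in> seg s"
  obtains "z \<in> oseg s" | m n where "z = pt m n"
proof -
  obtain h m n where s: "s = (h, m, n)" by (cases s)
  show thesis
  proof (cases "z \<in> oseg s")
    case False
    then have "if h then Im z = of_int n \<and> (Re z = of_int m \<or> Re z = of_int (m + 1))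
        else Re z = of_int m \<and> (Im z = of_int n \<or> Im z = of_int (n + 1))"
      using assms by (auto simp: s seg_def oseg_def)
    then have "z = pt m n \<or> z = pt (m + 1) n \<or> z = pt m (n + 1)"
      by (auto simp: complex_eq_iff split: if_splits)
    then show thesis using that(2) by blast
  qed (use that in auto)
qed

lemma no_int_between:
  assumes "of_int m < (of_int k :: real)" "of_int k < (of_int m + 1 :: real)"
  shows False
proof -
  have "of_int k < (of_int (m + 1) :: real)" using assms(2) by simp
  then show False using assms(1) unfolding of_int_less_iff by simp
qed

lemma oseg_not_lattice: "pt m n \<notin> oseg s"
proof
  obtain h m' n' where s: "s = (h, m', n')" by (cases s)
  assume "pt m n \<in> oseg s"
  then show False
    using no_int_between[of m' m] no_int_between[of n' n] by (cases h) (simp_all add: oseg_def s)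
qed

lemma int_interval_unique:
  fixes x :: real
  assumes "of_int m < x" "x < of_int m + 1" "of_int m' \<le> x" "x \<le> of_int m' + 1"
  shows "m' = m"
proof -
  have "of_int m < (of_int (m' + 1) :: real)" "of_int m' < (of_int (m + 1) :: real)"
    using assms by auto
  then show ?thesis
    unfolding of_int_less_iff by simp
qed

lemma oseg_meets_seg:
  assumes "z \<in> oseg s" "z \<in> seg t"
  shows "t = s"
proof -
  obtain h m n where s: "s = (h, m, n)" by (cases s)
  obtain h' m' n' where t: "t = (h', m', n')" by (cases t)
  show ?thesis
  proof (cases h)
    case True
    then have z: "Im z = of_int n" "of_int m < Re z" "Re z < of_int m + 1"
      using assms(1) by (auto simp: oseg_def s)
    show ?thesis
    proof (cases h')
      case True
      then have "Im z = of_int n'" "of_int m' \<le> Re z" "Re z \<le> of_int m' + 1"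
        using assms(2) by (auto simp: seg_def t)
      then show ?thesis
        using z int_interval_unique[of m "Re z" m'] \<open>h\<close> \<open>h'\<close> by (auto simp: s t)
    next
      case False
      then have "Re z = of_int m'"
        using assms(2) by (auto simp: seg_def t)
      then have False using z(2,3) no_int_between[of m m'] by simp
      then show ?thesis ..
    qed
  next
    case False
    then have z: "Re z = of_int m" "of_int n < Im z" "Im z < of_int n + 1"
      using assms(1) by (auto simp: oseg_def s)
    show ?thesis
    proof (cases h')
      case False
      then have "Re z = of_int m'" "of_int n' \<le> Im z" "Im z \<le> of_int n' + 1"
        using assms(2) by (auto simp: seg_def t)
      then show ?thesis
        using z int_interval_unique[of n "Im z" n'] \<open>\<not> h\<close> \<open>\<not> h'\<close> by (auto simp: s t)
    next
      case True
      then have "Im z = of_int n'"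
        using assms(2) by (auto simp: seg_def t)
      then have False using z(2,3) no_int_between[of n n'] by simp
      then show ?thesis ..
    qed
  qed
qed

lemma seg_near_lattice:
  assumes "z \<in> seg s" "dist z (pt m n) < 1/2"
  shows "pt m n \<in> seg s"
proof -
  obtain h m' n' where s: "s = (h, m', n')" by (cases s)
  have "\<bar>Re z - of_int m\<bar> < 1/2" "\<bar>Im z - of_int n\<bar> < 1/2"
    using assms(2) abs_Re_le_cmod[of "z - pt m n"] abs_Im_le_cmod[of "z - pt m n"]
    by (auto simp: dist_norm)
  then have c: "Re z - of_int m < 1/2" "of_int m - Re z < 1/2" "Im z - of_int n < 1/2" "of_int n - Im z < 1/2"
    by linarith+
  show ?thesis
  proof (cases h)
    case True
    then have "Im z = of_int n'" "of_int m' \<le> Re z" "Re z \<le> of_int m' + 1"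
      using assms(1) by (auto simp: seg_def s)
    then have "n = n'" "m' \<le> m" "m \<le> m' + 1" using c by linarith+
    then show ?thesis using True by (auto simp: seg_def s)
  next
    case False
    then have "Re z = of_int m'" "of_int n' \<le> Im z" "Im z \<le> of_int n' + 1"
      using assms(1) by (auto simp: seg_def s)
    then have "m = m'" "n' \<le> n" "n \<le> n' + 1" using c by linarith+
    then show ?thesis using False by (auto simp: seg_def s)
  qed
qed

lemma seg_subset_closure_oseg: "seg s \<subseteq> closure (oseg s)"
proof
  fix z assume z: "z \<in> seg s"
  have "z + of_real e * (mid s - z) \<in> oseg s" if "0 < e" "e \<le> 1" for e
  proof -
    obtain h m n where s: "s = (h, m, n)" by (cases s)
    have *: "(a::real) < x + e * (a + 1/2 - x) \<and> x + e * (a + 1/2 - x) < a + 1" if "a \<le> x" "x \<le> a + 1" for a x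
    proof -
      have "0 \<le> (1 - e) * (x - a)" "0 \<le> (1 - e) * (a + 1 - x)"
        using that \<open>e \<le> 1\<close> by simp_all
      then show ?thesis using \<open>0 < e\<close> by (simp add: algebra_simps)
    qed
    show ?thesis
      using z *[of "of_int m" "Re z"] *[of "of_int n" "Im z"]
      by (auto simp: seg_def oseg_def mid_def s split: if_splits)
  qed
  then have "\<forall>\<^sub>F e in at_right 0. z + of_real e * (mid s - z) \<in> closure (oseg s)"
    using closure_subset by (intro eventually_at_rightI[of 0 1]) fastforce+
  moreover have "((\<lambda>e. z + of_real e * (mid s - z)) \<longlongrightarrow> z + of_real 0 * (mid s - z)) (at_right 0)"
    by (intro tendsto_intros)
  ultimately show "z \<in> closure (oseg s)"
    using Lim_in_closed_set[of "closure (oseg s)" _ "at_right (0::real)"] by auto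
qed

section \<open>Edge colourings induced by colourings of unit segments\<close>

text \<open>Edges are components of the skeleton and may be long chains, while everything known
  about the tiling is local. Hence \<open>g\<close> colours unit segments: \<open>smooth\<close>
  carries a colour along a chain, \<open>proper\<close> separates chains at a vertex.\<close>

locale lattice_graph =
  fixes \<T> :: "complex set set" and E :: "(bool \<times> int \<times> int) set" and V :: "complex set"
    and g :: "bool \<times> int \<times> int \<Rightarrow> nat"
  assumes skeleton_eq: "skeleton \<T> = (\<Union>s\<in>E. seg s)"
    and V_lattice: "\<And>v. v \<in> V \<Longrightarrow> \<exists>m n. v = pt m n"
    and smooth: "\<And>m n s t. \<lbrakk>pt m n \<notin> V; s \<in> E; t \<in> E; pt m n \<in> seg s; pt m n \<in> seg t\<rbrakk> \<Longrightarrow> g s = g t"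
    and proper: "\<And>v. v \<in> V \<Longrightarrow> inj_on g {s \<in> E. v \<in> seg s}"
begin

definition seg_edge :: "bool \<times> int \<times> int \<Rightarrow> complex set" where
  "seg_edge s = connected_component_set (skeleton \<T> - V) (mid s)"

lemma oseg_subset_skeleton: "s \<in> E \<Longrightarrow> oseg s \<subseteq> skeleton \<T> - V"
  using oseg_subset[of s] oseg_not_lattice[of _ _ s] V_lattice unfolding skeleton_eq by blast

lemma seg_edge:
  assumes "s \<in> E"
  shows "seg_edge s \<in> tiling_edges \<T> V" "oseg s \<subseteq> seg_edge s"
  using oseg_subset_skeleton[OF assms] mid_in_oseg[of s] connected_oseg[of s]
    connected_component_maximal[of "mid s" "oseg s" "skeleton \<T> - V"]
  by (auto simp: seg_edge_def tiling_edges_def components_def)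

lemma seg_edge_unique:
  assumes "s \<in> E" "e \<in> tiling_edges \<T> V" "z \<in> oseg s" "z \<in> e"
  shows "e = seg_edge s"
  using seg_edge[OF assms(1)] assms components_nonoverlap[of e "skeleton \<T> - V" "seg_edge s"]
  unfolding tiling_edges_def by blast

lemma edge_monochromatic:
  assumes e: "e \<in> tiling_edges \<T> V" and st: "s \<in> E" "t \<in> E" "oseg s \<subseteq> e" "oseg t \<subseteq> e"
  shows "g s = g t"
proof (rule ccontr)
  assume ne: "g s \<noteq> g t"
  \<comment> \<open>The segments of colour \<open>g s\<close> and the remaining ones form two closed sets, which meet only at
    vertices; a connected set avoiding the vertices cannot meet both.\<close>
  let ?A = "\<Union>u\<in>{u \<in> E. g u = g s}. seg u" and ?B = "\<Union>u\<in>{u \<in> E. g u \<noteq> g s}. seg u"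
  have e': "connected e" "e \<subseteq> skeleton \<T> - V"
    using e in_components_connected in_components_subset unfolding tiling_edges_def by blast+
  have False if "z \<in> e" "u \<in> E" "w \<in> E" "g u = g s" "g w \<noteq> g s" "z \<in> seg u" "z \<in> seg w" for z u w
    using \<open>z \<in> seg u\<close>
  proof (cases rule: seg_cases)
    case 1
    then have "w = u" using oseg_meets_seg \<open>z \<in> seg w\<close> by blast
    then show False using that by simp
  next
    case (2 m n)
    then show False using smooth[of m n u w] that e'(2) by auto
  qed
  then have "?A \<inter> ?B \<inter> e = {}"
    by (auto simp del: split_paired_Ex)
  moreover have "e \<subseteq> ?A \<union> ?B"
    using e'(2) unfolding skeleton_eq by (auto simp del: split_paired_Ex)
  ultimately have "?A \<inter> e = {} \<or> ?B \<inter> e = {}"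
    using connected_closedD[OF e'(1), of ?A ?B] closed_UN_seg by blast
  moreover have "mid s \<in> ?A \<inter> e"
    by (intro IntI UN_I[of s]) (use st mid_in_oseg[of s] oseg_subset[of s] in auto)
  moreover have "mid t \<in> ?B \<inter> e"
    by (intro IntI UN_I[of t]) (use st ne mid_in_oseg[of t] oseg_subset[of t] in auto)
  ultimately show False
    by blast
qed

lemma edge_contains_oseg:
  assumes "e \<in> tiling_edges \<T> V" "v \<in> edge_ends V e"
  shows "\<exists>s\<in>E. v \<in> seg s \<and> e = seg_edge s"
proof -
  have sub: "e \<subseteq> skeleton \<T> - V"
    using assms(1) by (auto simp: tiling_edges_def dest: in_components_subset)
  have v: "v \<in> V" "v \<in> closure e"
    using assms(2) by (auto simp: edge_ends_def)
  obtain m n where mn: "v = pt m n"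
    using V_lattice v by blast
  \<comment> \<open>Radius 1/2: \<open>v\<close> is the only lattice point this close, and every
    segment with a point this close to \<open>v\<close> contains \<open>v\<close>.\<close>
  obtain z where z: "z \<in> e" "dist z v < 1/2"
    using v(2) unfolding closure_approachable by (meson half_gt_zero zero_less_one)
  obtain s where s: "s \<in> E" "z \<in> seg s"
    using z(1) sub unfolding skeleton_eq by blast
  have "z \<in> oseg s"
    using s(2)
  proof (cases rule: seg_cases)
    case (2 m' n')
    have "\<bar>of_int m' - of_int m :: real\<bar> < 1/2" "\<bar>of_int n' - of_int n :: real\<bar> < 1/2"
      using z(2) abs_Re_le_cmod[of "z - v"] abs_Im_le_cmod[of "z - v"] by (auto simp: dist_norm mn 2)
    then have "of_int \<bar>m' - m\<bar> < (1::real)" "of_int \<bar>n' - n\<bar> < (1::real)"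
      by auto
    then have "z = v"
      unfolding of_int_less_1_iff by (auto simp: mn 2)
    then show ?thesis using z(1) v(1) sub by blast
  qed
  then show ?thesis
    using seg_near_lattice[of z s m n] s z seg_edge_unique[OF s(1) assms(1)] mn by blast
qed

text \<open>Injectivity comes from the colouring: segments of one edge share a colour by
  \<open>edge_monochromatic\<close>, whereas \<open>g\<close> separates the segments at
  \<open>v\<close>. So no edge returns to \<open>v\<close>, and counting edges gives the
  degree.\<close>

lemma edges_at:
  assumes "v \<in> V"
  shows "bij_betw seg_edge {s \<in> E. v \<in> seg s} {e \<in> tiling_edges \<T> V. v \<in> edge_ends V e}"
proof (rule bij_betwI')
  fix s t assume s: "s \<in> {s \<in> E. v \<in> seg s}" and t: "t \<in> {s \<in> E. v \<in> seg s}"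
  show "seg_edge s = seg_edge t \<longleftrightarrow> s = t"
    using edge_monochromatic[of "seg_edge s" s t] seg_edge[of s] seg_edge[of t] proper[OF assms] s t
    by (auto dest: inj_onD)
next
  fix s assume s: "s \<in> {s \<in> E. v \<in> seg s}"
  then have "v \<in> closure (seg_edge s)"
    using seg_subset_closure_oseg[of s] closure_mono[OF seg_edge(2)[of s]] by blast
  then show "seg_edge s \<in> {e \<in> tiling_edges \<T> V. v \<in> edge_ends V e}"
    using s assms seg_edge[of s] by (auto simp: edge_ends_def)
next
  fix e assume "e \<in> {e \<in> tiling_edges \<T> V. v \<in> edge_ends V e}"
  then show "\<exists>s\<in>{s \<in> E. v \<in> seg s}. e = seg_edge s"
    using edge_contains_oseg[of e v] by blast
qed

lemma card_edges_at:
  "v \<in> V \<Longrightarrow> card {e \<in> tiling_edges \<T> V. v \<in> edge_ends V e} = card {s \<in> E. v \<in> seg s}"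
  by (rule bij_betw_same_card[OF edges_at, symmetric])

lemma chromatic_index_eq:
  assumes g: "\<And>s. s \<in> E \<Longrightarrow> g s < n" and v: "v \<in> V" "card {s \<in> E. v \<in> seg s} = n"
  shows "tiling_chromatic_index \<T> V = enat n"
proof -
  let ?E = "tiling_edges \<T> V"
  \<comment> \<open>An edge that is no \<open>seg_edge s\<close> has no end points by
    \<open>edge_contains_oseg\<close>, so the default 0 is harmless; it is below \<open>n\<close>
    because some segment has a colour below \<open>n\<close>.\<close>
  define c where "c e = (if \<exists>s\<in>E. e = seg_edge s then g (SOME s. s \<in> E \<and> e = seg_edge s) else 0)" for e
  have c: "c (seg_edge s) = g s" if "s \<in> E" for s
  proof -
    define t where "t = (SOME t. t \<in> E \<and> seg_edge s = seg_edge t)"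
    have t: "t \<in> E \<and> seg_edge s = seg_edge t"
      unfolding t_def by (rule someI[of _ s]) (use that in simp)
    then have "g t = g s"
      using edge_monochromatic[of "seg_edge s" t s] seg_edge[of s] seg_edge[of t] that by auto
    then show ?thesis
      using that unfolding c_def t_def[symmetric] by auto
  qed
  have "proper_edge_colouring ?E (edge_ends V) c"
    unfolding proper_edge_colouring_def
  proof (intro ballI impI)
    fix e f assume e: "e \<in> ?E" and f: "f \<in> ?E" and ef: "e \<noteq> f \<and> edge_ends V e \<inter> edge_ends V f \<noteq> {}"
    then obtain w where w: "w \<in> edge_ends V e" "w \<in> edge_ends V f" by blast
    obtain s t where "s \<in> E" "w \<in> seg s" "e = seg_edge s" "t \<in> E" "w \<in> seg t" "f = seg_edge t"
      using edge_contains_oseg[OF e w(1)] edge_contains_oseg[OF f w(2)] by blast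
    moreover have "w \<in> V"
      using w by (simp add: edge_ends_def)
    ultimately show "c e \<noteq> c f"
      using proper[of w] ef c by (auto dest!: inj_onD)
  qed
  moreover have "c e < n" if "e \<in> ?E" for e
  proof (cases "\<exists>s\<in>E. e = seg_edge s")
    case False
    have "e \<noteq> {}" "e \<subseteq> (\<Union>s\<in>E. seg s)"
      using that in_components_nonempty[of e] in_components_subset[of e]
      unfolding tiling_edges_def skeleton_eq by blast+
    then obtain s where "s \<in> E" by blast
    then have "n > 0"
      using g[of s] by simp
    then show ?thesis using False by (simp add: c_def)
  qed (use c g in auto)
  ultimately have "tiling_chromatic_index \<T> V \<le> enat n"
    unfolding tiling_chromatic_index_def chromatic_index_def by (intro Inf_lower) auto
  moreover have "enat n \<le> tiling_chromatic_index \<T> V"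
    unfolding tiling_chromatic_index_def chromatic_index_def
  proof (intro Inf_greatest)
    fix x assume "x \<in> {enat n |n. \<exists>c. proper_edge_colouring ?E (edge_ends V) c \<and> c ` ?E \<subseteq> {..<n}}"
    then obtain k c where x: "x = enat k" and c: "proper_edge_colouring ?E (edge_ends V) c" "c ` ?E \<subseteq> {..<k}"
      by blast
    let ?D = "{e \<in> ?E. v \<in> edge_ends V e}"
    have "inj_on c ?D"
      using c(1) unfolding proper_edge_colouring_def inj_on_def by blast
    moreover have "c ` ?D \<subseteq> {..<k}" using c(2) by blast
    ultimately have "card ?D \<le> card {..<k}"
      by (rule card_inj_on_le) simp
    then show "enat n \<le> x"
      using v card_edges_at[OF v(1)] x by simp
  qed
  ultimately show ?thesis by (rule antisym)
qed

end

lemma seg_through_pt: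
  "pt m n \<in> seg s \<longleftrightarrow> s \<in> {(True, m, n), (True, m - 1, n), (False, m, n), (False, m, n - 1)}"
proof -
  obtain h a b where s: "s = (h, a, b)" by (cases s)
  have *: "of_int a \<le> (of_int m :: real) \<and> (of_int m :: real) \<le> of_int a + 1 \<longleftrightarrow> a = m \<or> a = m - 1" for a m :: int
  proof -
    have "(of_int m :: real) \<le> of_int a + 1 \<longleftrightarrow> m \<le> a + 1"
      by (metis of_int_1 of_int_add of_int_le_iff)
    then show ?thesis by auto
  qed
  show ?thesis
    using *[of a m] *[of b n] by (cases h) (auto simp: seg_def s)
qed

text \<open>The parity of the number of points of \<open>P\<close> between 0 and \<open>k\<close>.
  The half-open intervals are chosen so that on either side of 0 the step from \<open>k - 1\<close>
  to \<open>k\<close> counts exactly the point \<open>k\<close>.\<close>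

lemma exists_flipping:
  fixes P :: "int \<Rightarrow> bool"
  shows "\<exists>f :: int \<Rightarrow> bool. \<forall>k. f k \<noteq> f (k - 1) \<longleftrightarrow> P k"
proof -
  let ?A = "\<lambda>k. {0<..k} \<inter> Collect P" and ?B = "\<lambda>k. {k<..0} \<inter> Collect P"
  have "odd (card (?A k) + card (?B k)) \<noteq> odd (card (?A (k - 1)) + card (?B (k - 1))) \<longleftrightarrow> P k" for k
  proof (cases "k > 0")
    case True
    then have "{0<..k} = insert k {0<..k - 1}" by auto
    with True have "?B k = {}" "?B (k - 1) = {}" "?A k = (if P k then insert k (?A (k - 1)) else ?A (k - 1))"
      by auto
    moreover have "finite (?A (k - 1))" "k \<notin> ?A (k - 1)" by simp_all
    ultimately show ?thesis by auto
  next
    case False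
    then have "{k - 1<..0} = insert k {k<..0}" by auto
    with False have "?A k = {}" "?A (k - 1) = {}" "?B (k - 1) = (if P k then insert k (?B k) else ?B k)"
      by auto
    moreover have "finite (?B k)" "k \<notin> ?B k" by simp_all
    ultimately show ?thesis by auto
  qed
  then show ?thesis
    by (intro exI[of _ "\<lambda>k. odd (card (?A k) + card (?B k))"] allI)
qed

section \<open>The pattern of cells\<close>

text \<open>\<open>own i j\<close> is the reflex corner of the tile that contains the unit cell with lower left corner
  \<open>(i, j)\<close>. A reflex corner belongs to one tile only, so it serves as a name of this tile.\<close>

locale chair_cells =
  fixes own :: "int \<Rightarrow> int \<Rightarrow> int \<times> int"
  assumes own_cases: "own i j \<in> {i, i + 1} \<times> {j, j + 1}"
    and own_even: "own i j = (p, q) \<Longrightarrow> even (p + q)"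
    and notch: "own i j = (p, q) \<Longrightarrow> \<exists>a\<in>{p - 1, p}. \<exists>b\<in>{q - 1, q}.
        \<forall>k\<in>{p - 1, p}. \<forall>l\<in>{q - 1, q}. own k l = (p, q) \<longleftrightarrow> (k, l) \<noteq> (a, b)"
    and own_subst: "\<lbrakk>\<alpha> \<in> {0, 1}; \<beta> \<in> {0, 1}\<rbrakk> \<Longrightarrow> own (2 * i + \<alpha>) (2 * j + \<beta>) =
        (if own i j = (i + \<alpha>, j + \<beta>) then (2 * (i + \<alpha>), 2 * (j + \<beta>)) else (2 * i + 1, 2 * j + 1))"
begin

definition hE :: "int \<Rightarrow> int \<Rightarrow> bool" where "hE m n \<longleftrightarrow> own m n \<noteq> own m (n - 1)"
definition vE :: "int \<Rightarrow> int \<Rightarrow> bool" where "vE m n \<longleftrightarrow> own m n \<noteq> own (m - 1) n"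

definition reflex :: "int \<Rightarrow> int \<Rightarrow> bool" where
  "reflex p q \<longleftrightarrow> (\<exists>i j. own i j = (p, q))"

text \<open>The cell \<open>(I, J)\<close> becomes a block of four cells, and its bend is the pair of segments inside the block.
  The ends of a bend have degree 3. The two segments at an even reflex corner likewise form one
  edge. Both kinds are coloured by the quadrant in which they lie as seen from a reflex corner: the
  tile it belongs to has a bend in three quadrants, the edge at the reflex corner lies in
  the fourth. The remaining segments lie on the boundaries of the blocks.\<close>

definition quadrant_colour :: "int \<Rightarrow> int \<Rightarrow> int \<Rightarrow> int \<Rightarrow> nat" where
  "quadrant_colour p q i j = (if (i = p) = (j = q) then of_bool (even i) else 2 + of_bool (even j))"

definition bend_colour :: "int \<Rightarrow> int \<Rightarrow> nat" where
  "bend_colour i j = quadrant_colour (fst (own i j)) (snd (own i j)) i j"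

text \<open>Of the four segments at a reflex corner only the two bounding the missing quarter are
  present, so \<open>hE p q\<close> and \<open>vE p q\<close> tell on which sides it lies.\<close>

definition notch_colour :: "int \<Rightarrow> int \<Rightarrow> nat" where
  "notch_colour p q = quadrant_colour p q (if hE p q then p else p - 1) (if vE p q then q else q - 1)"

text \<open>An odd transversal coordinate means that the segment is inside a block. On a block side,
  \<open>(m + 1) div 2\<close> is half of the even one of \<open>m\<close> and \<open>m + 1\<close>.
  Straight pieces use \<open>odd\<close> where \<open>quadrant_colour\<close> uses
  \<open>even\<close>, which keeps them apart from the bends and notches they meet.\<close>

definition branch_colour :: "bool \<times> int \<times> int \<Rightarrow> nat" where
  "branch_colour = (\<lambda>(h, m, n).
     if odd (if h then n else m) then bend_colour (m div 2) (n div 2)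
     else if h then
       (if reflex ((m + 1) div 2) (n div 2) then notch_colour ((m + 1) div 2) (n div 2)
        else of_bool (odd (m div 2)))
     else
       (if reflex (m div 2) ((n + 1) div 2) then notch_colour (m div 2) ((n + 1) div 2)
        else 2 + of_bool (odd (n div 2))))"

lemma own_subst_simps:
  "own (2 * i) (2 * j) = (if own i j = (i, j) then (2 * i, 2 * j) else (2 * i + 1, 2 * j + 1))"
  "own (2 * i + 1) (2 * j) = (if own i j = (i + 1, j) then (2 * i + 2, 2 * j) else (2 * i + 1, 2 * j + 1))"
  "own (2 * i) (2 * j + 1) = (if own i j = (i, j + 1) then (2 * i, 2 * j + 2) else (2 * i + 1, 2 * j + 1))"
  "own (2 * i + 1) (2 * j + 1) = (if own i j = (i + 1, j + 1) then (2 * i + 2, 2 * j + 2) else (2 * i + 1, 2 * j + 1))"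
  using own_subst[of 0 0 i j] own_subst[of 1 0 i j] own_subst[of 0 1 i j] own_subst[of 1 1 i j]
  by auto

lemma own_subst_pred:
  "own (2 * i - 1) n = own (2 * (i - 1) + 1) n" "own m (2 * j - 1) = own m (2 * (j - 1) + 1)"
  by simp_all

text \<open>The corners of a cell with even coordinate sum are two opposite ones.\<close>

lemma own_even_cell: "even (i + j) \<Longrightarrow> own i j = (i, j) \<or> own i j = (i + 1, j + 1)"
  using own_cases[of i j] own_even[of i j "i + 1" j] own_even[of i j i "j + 1"] by auto

lemma own_odd_cell: "odd (i + j) \<Longrightarrow> own i j = (i + 1, j) \<or> own i j = (i, j + 1)"
  using own_cases[of i j] own_even[of i j i j] own_even[of i j "i + 1" "j + 1"] by auto

lemma reflex_even: "reflex p q \<Longrightarrow> even (p + q)"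
  unfolding reflex_def using own_even by blast

lemma reflex_notch:
  assumes "reflex p q"
  shows "own p q \<noteq> (p, q) \<and> own (p - 1) q = (p, q) \<and> own p (q - 1) = (p, q) \<and> own (p - 1) (q - 1) = (p, q)
    \<or> own p q = (p, q) \<and> own (p - 1) q \<noteq> (p, q) \<and> own p (q - 1) = (p, q) \<and> own (p - 1) (q - 1) = (p, q)
    \<or> own p q = (p, q) \<and> own (p - 1) q = (p, q) \<and> own p (q - 1) \<noteq> (p, q) \<and> own (p - 1) (q - 1) = (p, q)
    \<or> own p q = (p, q) \<and> own (p - 1) q = (p, q) \<and> own p (q - 1) = (p, q) \<and> own (p - 1) (q - 1) \<noteq> (p, q)"
proof -
  obtain i j where "own i j = (p, q)"
    using assms unfolding reflex_def by blast
  from notch[OF this] show ?thesis by auto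
qed

text \<open>Half of a block side vanishes only inside a doubled tile whose reflex corner is the even
  end of that half; all other tiles stay within one block.\<close>

lemma hE_even:
  "hE (2 * i) (2 * j) \<longleftrightarrow> \<not> (own i j = (i, j) \<and> own i (j - 1) = (i, j))"
  "hE (2 * i + 1) (2 * j) \<longleftrightarrow> \<not> (own i j = (i + 1, j) \<and> own i (j - 1) = (i + 1, j))"
  "hE (2 * i - 1) (2 * j) \<longleftrightarrow> \<not> (own (i - 1) j = (i, j) \<and> own (i - 1) (j - 1) = (i, j))"
  unfolding hE_def own_subst_pred own_subst_simps by auto

lemma vE_even:
  "vE (2 * i) (2 * j) \<longleftrightarrow> \<not> (own i j = (i, j) \<and> own (i - 1) j = (i, j))"
  "vE (2 * i) (2 * j + 1) \<longleftrightarrow> \<not> (own i j = (i, j + 1) \<and> own (i - 1) j = (i, j + 1))"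
  "vE (2 * i) (2 * j - 1) \<longleftrightarrow> \<not> (own i (j - 1) = (i, j) \<and> own (i - 1) (j - 1) = (i, j))"
  unfolding vE_def own_subst_pred own_subst_simps by auto

text \<open>In a block just one cell does not belong to the central tile, namely the one at the
  block corner \<open>2 * own i j\<close>. The segments inside the block are the two sides of this
  cell that meet at the centre.\<close>

lemma hE_odd:
  "hE (2 * i) (2 * j + 1) \<longleftrightarrow> fst (own i j) = i"
  "hE (2 * i - 1) (2 * j + 1) \<longleftrightarrow> fst (own (i - 1) j) = i"
  "hE (2 * i + 1) (2 * j + 1) \<longleftrightarrow> fst (own i j) = i + 1"
  using own_cases[of i j] own_cases[of "i - 1" j]
  unfolding hE_def own_subst_pred add_diff_cancel_right' own_subst_simps by auto

lemma vE_odd: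
  "vE (2 * i + 1) (2 * j) \<longleftrightarrow> snd (own i j) = j"
  "vE (2 * i + 1) (2 * j - 1) \<longleftrightarrow> snd (own i (j - 1)) = j"
  "vE (2 * i + 1) (2 * j + 1) \<longleftrightarrow> snd (own i j) = j + 1"
  using own_cases[of i j] own_cases[of i "j - 1"]
  unfolding vE_def own_subst_pred add_diff_cancel_right' own_subst_simps by auto

lemma half_pred [simp]: "(2 * k - 1) div 2 = k - (1::int)"
  by presburger

lemma branch_colour_simps:
  "branch_colour (True, 2 * i, 2 * j) = (if reflex i j then notch_colour i j else of_bool (odd i))"
  "branch_colour (True, 2 * i + 1, 2 * j) = (if reflex (i + 1) j then notch_colour (i + 1) j else of_bool (odd i))"
  "branch_colour (True, 2 * i - 1, 2 * j) = (if reflex i j then notch_colour i j else of_bool (even i))"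
  "branch_colour (True, m, 2 * j + 1) = bend_colour (m div 2) j"
  "branch_colour (False, 2 * i, 2 * j) = (if reflex i j then notch_colour i j else 2 + of_bool (odd j))"
  "branch_colour (False, 2 * i, 2 * j + 1) = (if reflex i (j + 1) then notch_colour i (j + 1) else 2 + of_bool (odd j))"
  "branch_colour (False, 2 * i, 2 * j - 1) = (if reflex i j then notch_colour i j else 2 + of_bool (even j))"
  "branch_colour (False, 2 * i + 1, n) = bend_colour i (n div 2)"
proof -
  have "(2 * k + 1 + 1) div 2 = k + 1" for k :: int by presburger
  then show
    "branch_colour (True, 2 * i, 2 * j) = (if reflex i j then notch_colour i j else of_bool (odd i))"
    "branch_colour (True, 2 * i + 1, 2 * j) = (if reflex (i + 1) j then notch_colour (i + 1) j else of_bool (odd i))"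
    "branch_colour (True, 2 * i - 1, 2 * j) = (if reflex i j then notch_colour i j else of_bool (even i))"
    "branch_colour (True, m, 2 * j + 1) = bend_colour (m div 2) j"
    "branch_colour (False, 2 * i, 2 * j) = (if reflex i j then notch_colour i j else 2 + of_bool (odd j))"
    "branch_colour (False, 2 * i, 2 * j + 1) = (if reflex i (j + 1) then notch_colour i (j + 1) else 2 + of_bool (odd j))"
    "branch_colour (False, 2 * i, 2 * j - 1) = (if reflex i j then notch_colour i j else 2 + of_bool (even j))"
    "branch_colour (False, 2 * i + 1, n) = bend_colour i (n div 2)"
    by (simp_all add: branch_colour_def add.commute[of _ 1])
qed

section \<open>Consistency of the colour rule at every lattice point\<close>

definition coherent :: "int \<Rightarrow> int \<Rightarrow> bool" where
  "coherent m n \<longleftrightarrow>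
    (let r = hE m n; l = hE (m - 1) n; u = vE m n; d = vE m (n - 1);
         cr = branch_colour (True, m, n); cl = branch_colour (True, m - 1, n);
         cu = branch_colour (False, m, n); cd = branch_colour (False, m, n - 1)
     in if r \<and> l \<and> (u \<or> d) \<or> (r \<or> l) \<and> u \<and> d
        then (r \<and> l \<longrightarrow> cr \<noteq> cl) \<and> (r \<and> u \<longrightarrow> cr \<noteq> cu) \<and> (r \<and> d \<longrightarrow> cr \<noteq> cd) \<and>
          (l \<and> u \<longrightarrow> cl \<noteq> cu) \<and> (l \<and> d \<longrightarrow> cl \<noteq> cd) \<and> (u \<and> d \<longrightarrow> cu \<noteq> cd)
        else (r \<and> l \<longrightarrow> cr = cl) \<and> (r \<and> u \<longrightarrow> cr = cu) \<and> (r \<and> d \<longrightarrow> cr = cd) \<and>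
          (l \<and> u \<longrightarrow> cl = cu) \<and> (l \<and> d \<longrightarrow> cl = cd) \<and> (u \<and> d \<longrightarrow> cu = cd))"

text \<open>The centre of a block is the turning point of its bend; its degree is 2 and both arms
  carry the colour of the bend.\<close>

lemma coherent_odd_odd: "coherent (2 * i + 1) (2 * j + 1)"
proof -
  have "own i j \<in> {(i, j), (i, j + 1), (i + 1, j), (i + 1, j + 1)}"
    using own_cases[of i j] by auto
  then show ?thesis
    unfolding coherent_def add_diff_cancel_right' branch_colour_simps hE_odd vE_odd Let_def by auto
qed

text \<open>At a doubled reflex corner just the two sides of the notch remain, with one colour. At
  any other block corner all four segments are present, and opposite ones have halved positions of
  different parity.\<close>

lemma coherent_even_even: "coherent (2 * i) (2 * j)"
proof (cases "reflex i j")
  case True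
  then show ?thesis
    using reflex_notch[OF True]
    unfolding coherent_def branch_colour_simps hE_even vE_even Let_def by auto
next
  case False
  then have "own k l \<noteq> (i, j)" for k l
    by (auto simp: reflex_def)
  then show ?thesis
    using False unfolding coherent_def branch_colour_simps hE_even vE_even Let_def by auto
qed

text \<open>The midpoint of a horizontal block side. By parity at most one end of the side is a
  doubled reflex corner. Seen from it, the bends and the notch at the midpoint lie in the two
  quadrants adjoining the side, one coloured in {0, 1} and one in {2, 3}; the straight half has the
  other value in {0, 1}. If no bend ends here, the degree is 2 and both halves agree.\<close>

lemma coherent_odd_even: "coherent (2 * i + 1) (2 * j)"
proof (cases "even (i + j)")
  case True
  have A: "own i j = (i, j) \<or> own i j = (i + 1, j + 1)"
    using True by (rule own_even_cell)
  have B: "own i (j - 1) = (i, j) \<or> own i (j - 1) = (i + 1, j - 1)"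
    using own_odd_cell[of i "j - 1"] True by auto
  have "\<not> reflex (i + 1) j"
    using reflex_even[of "i + 1" j] True by auto
  \<comment> \<open>Three of the four cells around a reflex corner belong to its tile, so at least
    one of any two does.\<close>
  moreover have R: "reflex i j \<longleftrightarrow> own i j = (i, j) \<or> own i (j - 1) = (i, j)"
    using reflex_notch[of i j] by (auto simp: reflex_def)
  moreover have "notch_colour i j = 2 + of_bool (odd j)" "bend_colour i j = of_bool (even i)"
    if "own i j = (i, j)" "own i (j - 1) \<noteq> (i, j)"
    using that reflex_notch[of i j] R
    by (auto simp: notch_colour_def bend_colour_def quadrant_colour_def hE_def vE_def)
  moreover have "notch_colour i j = of_bool (even i)" "bend_colour i (j - 1) = 2 + of_bool (odd j)"
    if "own i j \<noteq> (i, j)" "own i (j - 1) = (i, j)"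
    using that reflex_notch[of i j] R
    by (auto simp: notch_colour_def bend_colour_def quadrant_colour_def hE_def vE_def)
  moreover have "bend_colour i j = of_bool (even i)" "bend_colour i (j - 1) = 2 + of_bool (odd j)"
    if "own i j = (i, j)" "own i (j - 1) = (i, j)"
    using that by (auto simp: bend_colour_def quadrant_colour_def)
  ultimately show ?thesis
    using A B unfolding coherent_def add_diff_cancel_right' branch_colour_simps hE_even vE_odd Let_def
    by (cases "own i j = (i, j)"; cases "own i (j - 1) = (i, j)"; cases "even i") simp_all
next
  case False
  have A: "own i j = (i + 1, j) \<or> own i j = (i, j + 1)"
    using False by (rule own_odd_cell)
  have B: "own i (j - 1) = (i + 1, j) \<or> own i (j - 1) = (i, j - 1)"
    using own_even_cell[of i "j - 1"] False by auto
  have "\<not> reflex i j"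
    using reflex_even[of i j] False by auto
  moreover have R: "reflex (i + 1) j \<longleftrightarrow> own i j = (i + 1, j) \<or> own i (j - 1) = (i + 1, j)"
    using reflex_notch[of "i + 1" j] by (auto simp: reflex_def)
  moreover have "notch_colour (i + 1) j = of_bool (even i)" "bend_colour i j = 2 + of_bool (even j)"
    if "own i j = (i + 1, j)" "own i (j - 1) \<noteq> (i + 1, j)"
    using that reflex_notch[of "i + 1" j] R
    by (auto simp: notch_colour_def bend_colour_def quadrant_colour_def hE_def vE_def)
  moreover have "notch_colour (i + 1) j = 2 + of_bool (even j)" "bend_colour i (j - 1) = of_bool (even i)"
    if "own i j \<noteq> (i + 1, j)" "own i (j - 1) = (i + 1, j)"
    using that reflex_notch[of "i + 1" j] R
    by (auto simp: notch_colour_def bend_colour_def quadrant_colour_def hE_def vE_def)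
  moreover have "bend_colour i j = 2 + of_bool (even j)" "bend_colour i (j - 1) = of_bool (even i)"
    if "own i j = (i + 1, j)" "own i (j - 1) = (i + 1, j)"
    using that by (auto simp: bend_colour_def quadrant_colour_def)
  ultimately show ?thesis
    using A B unfolding coherent_def add_diff_cancel_right' branch_colour_simps hE_even vE_odd Let_def
    by (cases "own i j = (i + 1, j)"; cases "own i (j - 1) = (i + 1, j)"; cases "even i") simp_all
qed

text \<open>The analogue for vertical sides: now the straight half shares {2, 3} with one of the
  adjoining quadrants and differs from it by the parity of \<open>j\<close>.\<close>

lemma coherent_even_odd: "coherent (2 * i) (2 * j + 1)"
proof (cases "even (i + j)")
  case True
  have A: "own i j = (i, j) \<or> own i j = (i + 1, j + 1)"
    using True by (rule own_even_cell)
  have B: "own (i - 1) j = (i, j) \<or> own (i - 1) j = (i - 1, j + 1)"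
    using own_odd_cell[of "i - 1" j] True by auto
  have "\<not> reflex i (j + 1)"
    using reflex_even[of i "j + 1"] True by auto
  moreover have R: "reflex i j \<longleftrightarrow> own i j = (i, j) \<or> own (i - 1) j = (i, j)"
    using reflex_notch[of i j] by (auto simp: reflex_def)
  moreover have "notch_colour i j = 2 + of_bool (even j)" "bend_colour i j = of_bool (even i)"
    if "own i j = (i, j)" "own (i - 1) j \<noteq> (i, j)"
    using that reflex_notch[of i j] R
    by (auto simp: notch_colour_def bend_colour_def quadrant_colour_def hE_def vE_def)
  moreover have "notch_colour i j = of_bool (even i)" "bend_colour (i - 1) j = 2 + of_bool (even j)"
    if "own i j \<noteq> (i, j)" "own (i - 1) j = (i, j)"
    using that reflex_notch[of i j] R
    by (auto simp: notch_colour_def bend_colour_def quadrant_colour_def hE_def vE_def)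
  moreover have "bend_colour i j = of_bool (even i)" "bend_colour (i - 1) j = 2 + of_bool (even j)"
    if "own i j = (i, j)" "own (i - 1) j = (i, j)"
    using that by (auto simp: bend_colour_def quadrant_colour_def)
  ultimately show ?thesis
    using A B unfolding coherent_def add_diff_cancel_right' branch_colour_simps hE_odd vE_even Let_def
    by (cases "own i j = (i, j)"; cases "own (i - 1) j = (i, j)"; cases "even j") simp_all
next
  case False
  have A: "own i j = (i, j + 1) \<or> own i j = (i + 1, j)"
    using own_odd_cell[OF False] by blast
  have B: "own (i - 1) j = (i, j + 1) \<or> own (i - 1) j = (i - 1, j)"
    using own_even_cell[of "i - 1" j] False by auto
  have "\<not> reflex i j"
    using reflex_even[of i j] False by auto
  moreover have R: "reflex i (j + 1) \<longleftrightarrow> own i j = (i, j + 1) \<or> own (i - 1) j = (i, j + 1)"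
    using reflex_notch[of i "j + 1"] by (auto simp: reflex_def)
  moreover have "notch_colour i (j + 1) = of_bool (odd i)" "bend_colour i j = 2 + of_bool (even j)"
    if "own i j = (i, j + 1)" "own (i - 1) j \<noteq> (i, j + 1)"
    using that reflex_notch[of i "j + 1"] R
    by (auto simp: notch_colour_def bend_colour_def quadrant_colour_def hE_def vE_def)
  moreover have "notch_colour i (j + 1) = 2 + of_bool (even j)" "bend_colour (i - 1) j = of_bool (odd i)"
    if "own i j \<noteq> (i, j + 1)" "own (i - 1) j = (i, j + 1)"
    using that reflex_notch[of i "j + 1"] R
    by (auto simp: notch_colour_def bend_colour_def quadrant_colour_def hE_def vE_def)
  moreover have "bend_colour i j = 2 + of_bool (even j)" "bend_colour (i - 1) j = of_bool (odd i)"
    if "own i j = (i, j + 1)" "own (i - 1) j = (i, j + 1)"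
    using that by (auto simp: bend_colour_def quadrant_colour_def)
  ultimately show ?thesis
    using A B unfolding coherent_def add_diff_cancel_right' branch_colour_simps hE_odd vE_even Let_def
    by (cases "own i j = (i, j + 1)"; cases "own (i - 1) j = (i, j + 1)"; cases "even j") simp_all
qed

lemma coherent: "coherent m n"
proof -
  obtain i j where "m = 2 * i \<or> m = 2 * i + 1" "n = 2 * j \<or> n = 2 * j + 1"
    by (metis oddE evenE)
  then show ?thesis
    using coherent_odd_odd coherent_even_even coherent_odd_even coherent_even_odd by auto
qed

end

section \<open>Chromatic index for the three choices of vertices\<close>

locale chair_graph = chair_cells +
  fixes \<T> :: "complex set set"
  assumes skeleton_eq: "skeleton \<T> = (\<Union>s\<in>{(h, m, n). if h then hE m n else vE m n}. seg s)"
begin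

definition segs :: "(bool \<times> int \<times> int) set" where
  "segs = {(h, m, n). if h then hE m n else vE m n}"

lemma skeleton_segs: "skeleton \<T> = (\<Union>s\<in>segs. seg s)"
  unfolding skeleton_eq segs_def ..

lemma segs_at:
  "{s \<in> segs. pt m n \<in> seg s} =
    (if hE m n then {(True, m, n)} else {}) \<union> (if hE (m - 1) n then {(True, m - 1, n)} else {}) \<union>
    (if vE m n then {(False, m, n)} else {}) \<union> (if vE m (n - 1) then {(False, m, n - 1)} else {})"
  by (auto simp: seg_through_pt segs_def)

lemma card_segs_at:
  "card {s \<in> segs. pt m n \<in> seg s} =
    of_bool (hE m n) + of_bool (hE (m - 1) n) + of_bool (vE m n) + of_bool (vE m (n - 1))"
  unfolding segs_at by auto

text \<open>The halved point (1, 0) has odd coordinate sum, so it is no reflex corner and no segment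
  vanishes at (2, 0). This vertex provides the lower bound in all three cases.\<close>

lemma crossing: "hE 2 0" "hE (2 - 1) 0" "vE 2 0" "vE 2 (0 - 1)"
  using hE_even[of 1 0] vE_even[of 1 0] own_even[of _ _ 1 0] by auto

lemma card_crossing: "card {s \<in> segs. pt 2 0 \<in> seg s} = 4"
  unfolding card_segs_at using crossing by simp

lemma lattice_graph_all:
  "lattice_graph \<T> segs {v. \<exists>m n. v = pt m n}
    (\<lambda>(h, m, n). if h then of_bool (odd m) else 2 + of_bool (odd n))"
proof
  fix v assume "v \<in> {v. \<exists>m n. v = pt m n}"
  then obtain m n where "v = pt m n" by blast
  show "inj_on (\<lambda>(h, m, n). if h then of_bool (odd m) else 2 + of_bool (odd n) :: nat) {s \<in> segs. v \<in> seg s}"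
    unfolding \<open>v = pt m n\<close> segs_at by auto
qed (use skeleton_segs in auto)

lemma index_all: "tiling_chromatic_index \<T> {v. \<exists>m n. v = pt m n} = 4"
  using lattice_graph.chromatic_index_eq[OF lattice_graph_all, of 4 "pt 2 0"] card_crossing
  by (auto simp: numeral_eq_enat)

lemma card_edges_at_lattice:
  "card {e \<in> tiling_edges \<T> {v. \<exists>m n. v = pt m n}. pt m n \<in> edge_ends {v. \<exists>m n. v = pt m n} e}
    = card {s \<in> segs. pt m n \<in> seg s}"
  by (rule lattice_graph.card_edges_at[OF lattice_graph_all]) auto

lemma in_segs_at:
  "s \<in> segs \<and> pt m n \<in> seg s \<longleftrightarrow> s = (True, m, n) \<and> hE m n \<or> s = (True, m - 1, n) \<and> hE (m - 1) n \<or>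
    s = (False, m, n) \<and> vE m n \<or> s = (False, m, n - 1) \<and> vE m (n - 1)"
  by (auto simp: seg_through_pt segs_def)

lemma three_segs_at:
  "3 \<le> card {s \<in> segs. pt m n \<in> seg s} \<longleftrightarrow>
    hE m n \<and> hE (m - 1) n \<and> (vE m n \<or> vE m (n - 1)) \<or> (hE m n \<or> hE (m - 1) n) \<and> vE m n \<and> vE m (n - 1)"
  unfolding card_segs_at by (simp add: of_bool_def)

lemma branch_colour_smooth:
  assumes "\<not> 3 \<le> card {s \<in> segs. pt m n \<in> seg s}"
    and s: "s \<in> segs \<and> pt m n \<in> seg s" and t: "t \<in> segs \<and> pt m n \<in> seg t"
  shows "branch_colour s = branch_colour t"
proof -
  have "coherent m n" by (rule coherent)
  then have "(hE m n \<and> hE (m - 1) n \<longrightarrow> branch_colour (True, m, n) = branch_colour (True, m - 1, n)) \<and>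
      (hE m n \<and> vE m n \<longrightarrow> branch_colour (True, m, n) = branch_colour (False, m, n)) \<and>
      (hE m n \<and> vE m (n - 1) \<longrightarrow> branch_colour (True, m, n) = branch_colour (False, m, n - 1)) \<and>
      (hE (m - 1) n \<and> vE m n \<longrightarrow> branch_colour (True, m - 1, n) = branch_colour (False, m, n)) \<and>
      (hE (m - 1) n \<and> vE m (n - 1) \<longrightarrow> branch_colour (True, m - 1, n) = branch_colour (False, m, n - 1)) \<and>
      (vE m n \<and> vE m (n - 1) \<longrightarrow> branch_colour (False, m, n) = branch_colour (False, m, n - 1))"
    using assms(1) unfolding coherent_def Let_def three_segs_at by (simp only: if_False)
  then show ?thesis
    using s t unfolding in_segs_at by (elim disjE conjE) simp_all
qed

lemma branch_colour_proper:
  assumes "3 \<le> card {s \<in> segs. pt m n \<in> seg s}"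
  shows "inj_on branch_colour {s \<in> segs. pt m n \<in> seg s}"
proof (rule inj_onI)
  fix s t assume "s \<in> {s \<in> segs. pt m n \<in> seg s}" "t \<in> {s \<in> segs. pt m n \<in> seg s}"
    and eq: "branch_colour s = branch_colour t"
  then have st: "s \<in> segs \<and> pt m n \<in> seg s" "t \<in> segs \<and> pt m n \<in> seg t" by blast+
  have "coherent m n" by (rule coherent)
  then have "(hE m n \<and> hE (m - 1) n \<longrightarrow> branch_colour (True, m, n) \<noteq> branch_colour (True, m - 1, n)) \<and>
      (hE m n \<and> vE m n \<longrightarrow> branch_colour (True, m, n) \<noteq> branch_colour (False, m, n)) \<and>
      (hE m n \<and> vE m (n - 1) \<longrightarrow> branch_colour (True, m, n) \<noteq> branch_colour (False, m, n - 1)) \<and>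
      (hE (m - 1) n \<and> vE m n \<longrightarrow> branch_colour (True, m - 1, n) \<noteq> branch_colour (False, m, n)) \<and>
      (hE (m - 1) n \<and> vE m (n - 1) \<longrightarrow> branch_colour (True, m - 1, n) \<noteq> branch_colour (False, m, n - 1)) \<and>
      (vE m n \<and> vE m (n - 1) \<longrightarrow> branch_colour (False, m, n) \<noteq> branch_colour (False, m, n - 1))"
    using assms unfolding coherent_def Let_def three_segs_at by (simp only: if_True)
  then show "s = t"
    using st eq unfolding in_segs_at by (elim disjE conjE) simp_all
qed

lemma index_branch:
  "tiling_chromatic_index \<T> {v. \<exists>m n. v = pt m n \<and> 3 \<le> card {s \<in> segs. pt m n \<in> seg s}} = 4"
    (is "tiling_chromatic_index \<T> ?V = 4")
proof -
  have "lattice_graph \<T> segs ?V branch_colour"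
  proof
    fix m n s t
    assume nV: "pt m n \<notin> ?V" and st: "s \<in> segs" "t \<in> segs" "pt m n \<in> seg s" "pt m n \<in> seg t"
    have "\<not> 3 \<le> card {s \<in> segs. pt m n \<in> seg s}"
      using nV by blast
    then show "branch_colour s = branch_colour t"
      using st by (intro branch_colour_smooth) simp_all
  next
    fix v assume "v \<in> ?V"
    then show "inj_on branch_colour {s \<in> segs. v \<in> seg s}"
      using branch_colour_proper by blast
  qed (use skeleton_segs in auto)
  moreover have "quadrant_colour p q i j < 4" for p q i j
    by (simp add: quadrant_colour_def)
  then have "branch_colour s < 4" for s
    by (cases s) (simp add: branch_colour_def bend_colour_def notch_colour_def)
  moreover have "3 \<le> card {s \<in> segs. pt 2 0 \<in> seg s}"
    unfolding card_crossing by simp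
  then have "pt 2 0 \<in> ?V"
    by blast
  ultimately have "tiling_chromatic_index \<T> ?V = enat 4"
    using card_crossing by (rule lattice_graph.chromatic_index_eq)
  then show ?thesis
    by (simp only: numeral_eq_enat)
qed

text \<open>Outside \<open>V\<close> only segments of one direction meet, so the directions can
  divide the colours into {0, 1} and {2, 3}. Vertices follow each other at irregular distances,
  hence each row and each column gets its own flipping function.\<close>

lemma index_corner:
  assumes V: "\<And>v. v \<in> V \<Longrightarrow> \<exists>m n. v = pt m n"
    and corner: "\<And>m n. \<lbrakk>hE m n \<or> hE (m - 1) n; vE m n \<or> vE m (n - 1)\<rbrakk> \<Longrightarrow> pt m n \<in> V"
  shows "tiling_chromatic_index \<T> V = 4"
proof -
  have "\<forall>n. \<exists>f :: int \<Rightarrow> bool. \<forall>m. (f m \<noteq> f (m - 1)) = (pt m n \<in> V)"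
    by (intro allI exists_flipping)
  from choice[OF this] obtain f :: "int \<Rightarrow> int \<Rightarrow> bool"
    where "\<forall>n m. (f n m \<noteq> f n (m - 1)) = (pt m n \<in> V)" by (elim exE)
  then have f: "(f n m \<noteq> f n (m - 1)) = (pt m n \<in> V)" for n m
    by simp
  have "\<forall>m. \<exists>f :: int \<Rightarrow> bool. \<forall>n. (f n \<noteq> f (n - 1)) = (pt m n \<in> V)"
    by (intro allI exists_flipping)
  from choice[OF this] obtain f' :: "int \<Rightarrow> int \<Rightarrow> bool"
    where "\<forall>m n. (f' m n \<noteq> f' m (n - 1)) = (pt m n \<in> V)" by (elim exE)
  then have f': "(f' m n \<noteq> f' m (n - 1)) = (pt m n \<in> V)" for m n
    by simp
  let ?g = "\<lambda>(h, m, n). if h then of_bool (f n m) else 2 + of_bool (f' m n) :: nat"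
  have "lattice_graph \<T> segs V ?g"
  proof
    fix m n s t
    assume nV: "pt m n \<notin> V" and st: "s \<in> segs" "t \<in> segs" "pt m n \<in> seg s" "pt m n \<in> seg t"
    have "s \<in> {s \<in> segs. pt m n \<in> seg s}" "t \<in> {s \<in> segs. pt m n \<in> seg s}"
      using st by blast+
    then show "?g s = ?g t"
      using corner[of m n] nV f[of n m] f'[of m n] unfolding segs_at
      by (auto split: if_splits)
  next
    fix v assume "v \<in> V"
    then obtain m n where v: "v = pt m n" "pt m n \<in> V" using V by blast
    show "inj_on ?g {s \<in> segs. v \<in> seg s}"
      using v f[of n m] f'[of m n] unfolding v segs_at by (auto simp: inj_on_def)
  qed (use skeleton_segs V in auto)
  moreover have "?g s < 4" for s
    by (auto split: prod.split)
  moreover have "pt 2 0 \<in> V"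
    using corner[of 2 0] crossing by blast
  ultimately have "tiling_chromatic_index \<T> V = enat 4"
    using card_crossing by (rule lattice_graph.chromatic_index_eq)
  then show ?thesis
    by (simp only: numeral_eq_enat)
qed

end

section \<open>Tiles\<close>

text \<open>The tile with reflex corner \<open>r\<close> whose missing quarter lies in the direction \<open>s \<in> {\<plusminus>1 \<plusminus> \<i>}\<close>. Substitution
  turns it into \<open>tile (2r) s\<close> and the tiles \<open>tile (2r + u) (-u)\<close> with \<open>u \<noteq> s\<close>.\<close>

definition tile :: "complex \<Rightarrow> complex \<Rightarrow> complex set" where
  "tile r s = {z. \<bar>Re z - Re r\<bar> \<le> 1 \<and> \<bar>Im z - Im r\<bar> \<le> 1 \<and>
    \<not> (0 < (Re z - Re r) * Re s \<and> 0 < (Im z - Im r) * Im s)}"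

definition diag :: "complex set" where
  "diag = {Complex 1 1, Complex 1 (- 1), Complex (- 1) 1, Complex (- 1) (- 1)}"

text \<open>The open unit squares of which a tile consists, one for each direction \<open>u\<close>
  other than the notch. They stand in for the interior of the tile, which is never computed.\<close>

definition quad :: "complex \<Rightarrow> complex \<Rightarrow> complex set" where
  "quad r u = {z. 0 < (Re z - Re r) * Re u \<and> (Re z - Re r) * Re u < 1 \<and>
    0 < (Im z - Im r) * Im u \<and> (Im z - Im r) * Im u < 1}"

lemma diag_iff: "u \<in> diag \<longleftrightarrow> (Re u = 1 \<or> Re u = - 1) \<and> (Im u = 1 \<or> Im u = - 1)"
  by (auto simp: diag_def complex_eq_iff)

lemma tile_alt: "tile r s = {z. \<bar>Re z - Re r\<bar> \<le> 1} \<inter> {z. \<bar>Im z - Im r\<bar> \<le> 1} \<inter>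
    ({z. (Re z - Re r) * Re s \<le> 0} \<union> {z. (Im z - Im r) * Im s \<le> 0})"
  by (auto simp: tile_def not_less)

lemma closed_tile: "closed (tile r s)"
  unfolding tile_alt by (intro closed_Int closed_Un closed_Collect_le continuous_intros)

lemma closure_square_minus_quadrant:
  assumes "s \<in> diag"
  shows "closure {z. \<bar>Re z - Re r\<bar> \<le> 1 \<and> \<bar>Im z - Im r\<bar> \<le> 1 \<and>
    \<not> (0 \<le> (Re z - Re r) * Re s \<and> 0 \<le> (Im z - Im r) * Im s)} = tile r s" (is "closure ?S = _")
proof
  show "closure ?S \<subseteq> tile r s"
    by (rule closure_minimal[OF _ closed_tile]) (auto simp: tile_def)
  show "tile r s \<subseteq> closure ?S"
  proof
    fix z assume z: "z \<in> tile r s"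
    \<comment> \<open>A point on the boundary lines of the missing quadrant is approached by moving
      away from the quadrant, against the sign of \<open>Re s\<close> or
      \<open>Im s\<close>.\<close>
    have lim: "z \<in> closure ?S" if "\<And>e. \<lbrakk>0 < e; e < 1\<rbrakk> \<Longrightarrow> z - of_real e * w \<in> ?S" for w
    proof -
      have "\<forall>\<^sub>F e in at_right 0. z - of_real e * w \<in> closure ?S"
        using that closure_subset[of ?S] by (intro eventually_at_rightI[of 0 1]) (auto simp: subset_iff)
      moreover have "((\<lambda>e. z - of_real e * w) \<longlongrightarrow> z - of_real 0 * w) (at_right 0)"
        by (intro tendsto_intros)
      ultimately show ?thesis
        using Lim_in_closed_set[of "closure ?S" _ "at_right (0::real)"] by auto
    qed
    have *: "a \<le> 0 \<or> b \<le> 0 \<Longrightarrow> (a < 0 \<or> b < 0) \<or> a = 0 \<or> b = 0" for a b :: real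
      by auto
    have "z \<in> ?S \<or> (Re z - Re r) * Re s = 0 \<or> (Im z - Im r) * Im s = 0"
      using z *[of "(Re z - Re r) * Re s" "(Im z - Im r) * Im s"]
      by (simp only: tile_def mem_Collect_eq de_Morgan_conj not_le not_less) blast
    then show "z \<in> closure ?S"
    proof (elim disjE)
      assume "z \<in> ?S"
      then show ?thesis by (rule closure_subset[THEN subsetD])
    next
      assume "(Re z - Re r) * Re s = 0"
      then have "Re z = Re r" "Re s * Re s = 1"
        using assms by (auto simp: diag_iff)
      then show ?thesis
        using z assms by (intro lim[of "of_real (Re s)"]) (auto simp: tile_def diag_iff)
    next
      assume "(Im z - Im r) * Im s = 0"
      then have "Im z = Im r" "Im s * Im s = 1"
        using assms by (auto simp: diag_iff)
      then show ?thesis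
        using z assms by (intro lim[of "\<i> * of_real (Im s)"]) (auto simp: tile_def diag_iff)
    qed
  qed
qed

lemma closure_cbox_diff:
  assumes "{z. \<bar>Re z - Re r\<bar> \<le> 1 \<and> \<bar>Im z - Im r\<bar> \<le> 1 \<and>
      \<not> (0 \<le> (Re z - Re r) * Re s \<and> 0 \<le> (Im z - Im r) * Im s)} = A" and "s \<in> diag"
  shows "closure A = tile r s"
  using closure_square_minus_quadrant[OF assms(2), of r] assms(1) by simp

lemma chair_eq_tile: "chair = tile (Complex 1 1) (Complex 1 1)"
  unfolding chair_def
  by (rule closure_cbox_diff) (auto simp: in_cbox_complex_iff diag_iff abs_le_iff)

lemma translation_tile: "(\<lambda>z. z + t) ` tile r s = tile (r + t) s"
proof -
  have "z \<in> (\<lambda>z. z + t) ` tile r s \<longleftrightarrow> z - t \<in> tile r s" for z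
    by (force intro: image_eqI[of _ _ "z - t"])
  then show ?thesis
    by (auto simp: tile_def algebra_simps)
qed

lemma rotation_tile: "(\<lambda>z. \<i> * z) ` tile r s = tile (\<i> * r) (\<i> * s)"
proof -
  have "z \<in> (\<lambda>z. \<i> * z) ` tile r s \<longleftrightarrow> z \<in> tile (\<i> * r) (\<i> * s)" for z
  proof -
    have "z \<in> (\<lambda>z. \<i> * z) ` tile r s \<longleftrightarrow> - \<i> * z \<in> tile r s"
    proof
      assume "z \<in> (\<lambda>z. \<i> * z) ` tile r s"
      then obtain w where "w \<in> tile r s" "z = \<i> * w" by blast
      then show "- \<i> * z \<in> tile r s" by (simp add: mult.assoc[symmetric])
    next
      assume "- \<i> * z \<in> tile r s"
      then show "z \<in> (\<lambda>z. \<i> * z) ` tile r s"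
        by (intro image_eqI[of _ _ "- \<i> * z"]) (simp_all add: mult.assoc[symmetric])
    qed
    moreover have "\<bar>- Re z - Im r\<bar> = \<bar>Re z + Im r\<bar>" "(- Re z - Im r) * Im s = - ((Re z + Im r) * Im s)"
      by (simp_all add: abs_if algebra_simps)
    ultimately show ?thesis
      by (simp add: tile_def) blast
  qed
  then show ?thesis by blast
qed

lemma motion_tile: "motion k t ` tile r s = tile (\<i> ^ k * r + t) (\<i> ^ k * s)"
proof -
  have "(\<lambda>z. \<i> ^ k * z) ` tile r s = tile (\<i> ^ k * r) (\<i> ^ k * s)"
  proof (induction k)
    case (Suc k)
    have "(\<lambda>z. \<i> ^ Suc k * z) ` tile r s = (\<lambda>z. \<i> * z) ` (\<lambda>z. \<i> ^ k * z) ` tile r s"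
      by (simp add: image_image mult.assoc)
    then show ?case
      by (simp add: Suc rotation_tile mult.assoc)
  qed simp
  moreover have "motion k t ` tile r s = (\<lambda>z. z + t) ` (\<lambda>z. \<i> ^ k * z) ` tile r s"
    by (simp add: image_image motion_def)
  ultimately show ?thesis
    by (simp add: translation_tile)
qed

lemma rotation_diag: "\<i> ^ k * u \<in> diag \<longleftrightarrow> u \<in> diag"
proof (induction k)
  case (Suc k)
  have "\<i> * v \<in> diag \<longleftrightarrow> v \<in> diag" for v
    by (auto simp: diag_iff)
  then show ?case using Suc by (simp add: mult.assoc)
qed simp

lemma diag_rotations:
  assumes "s \<in> diag"
  obtains k where "s = \<i> ^ k * Complex 1 1"
proof -
  have "\<i> ^ 0 * Complex 1 1 = Complex 1 1" "\<i> ^ 1 * Complex 1 1 = Complex (- 1) 1"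
    "\<i> ^ 2 * Complex 1 1 = Complex (- 1) (- 1)" "\<i> ^ 3 * Complex 1 1 = Complex 1 (- 1)"
    by (simp_all add: complex_eq_iff eval_nat_numeral)
  then show thesis
    using assms that unfolding diag_def by (metis insertE singletonD)
qed

lemma motion_chair: "motion k t ` chair = tile (\<i> ^ k * Complex 1 1 + t) (\<i> ^ k * Complex 1 1)"
  unfolding chair_eq_tile motion_tile ..

lemma tile_eq_motion_chair:
  assumes "s \<in> diag"
  obtains k t where "motion k t ` chair = tile r s" "r = \<i> ^ k * Complex 1 1 + t" "s = \<i> ^ k * Complex 1 1"
proof -
  obtain k where "s = \<i> ^ k * Complex 1 1" using diag_rotations[OF assms] .
  then show thesis
    using that[of k "r - s"] by (simp add: motion_chair)
qed

text \<open>Three corners of the square around \<open>r\<close> lie in the tile and determine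
  \<open>r\<close>; the absent fourth corner \<open>r + s\<close> determines \<open>s\<close>. Pairs
  can therefore stand for tiles.\<close>

lemma tile_inject:
  assumes "s \<in> diag" "s' \<in> diag" "tile r s = tile r' s'"
  shows "r = r' \<and> s = s'"
proof -
  have corner: "r + u \<in> tile r s" if "u \<in> diag" "u \<noteq> s" "s \<in> diag" for r u s
    using that by (auto simp: tile_def diag_iff complex_eq_iff)
  have le: "r = r'" if "s \<in> diag" "tile r s \<subseteq> tile r' s'" for r s r' s'
  proof -
    have "\<bar>Re r + a - Re r'\<bar> \<le> 1 \<and> \<bar>Im r + b - Im r'\<bar> \<le> 1" if "Complex a b \<in> diag - {s}" for a b
    proof -
      have "r + Complex a b \<in> tile r' s'"
        using corner[of "Complex a b" s r] that \<open>s \<in> diag\<close> \<open>tile r s \<subseteq> tile r' s'\<close> by blast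
      then show ?thesis by (simp add: tile_def)
    qed
    from this[of 1 1] this[of 1 "-1"] this[of "-1" 1] this[of "-1" "-1"]
    have "Re r = Re r'" "Im r = Im r'"
      using \<open>s \<in> diag\<close> by (auto simp: diag_iff complex_eq_iff)
    then show ?thesis by (rule complex_eqI)
  qed
  have "r = r'" using le[of s r r' s'] assms by blast
  moreover have "s = s'"
  proof (rule ccontr)
    assume "s \<noteq> s'"
    then have "r + s \<in> tile r s'" using corner assms by blast
    moreover have "r + s \<notin> tile r s" using assms(1) by (auto simp: tile_def diag_iff)
    ultimately show False using assms(3) \<open>r = r'\<close> by blast
  qed
  ultimately show ?thesis ..
qed

lemma chair_dissection_eq:
  "chair_dissection = insert (tile (2 * Complex 1 1) (Complex 1 1))
    {tile (2 * Complex 1 1 + u) (- u) | u. u \<in> diag - {Complex 1 1}}"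
proof -
  have a: "closure (cbox (Complex 0 2) (Complex 2 4) - cbox (Complex 1 2) (Complex 2 3)) = tile (Complex 1 3) (Complex 1 (- 1))"
    by (rule closure_cbox_diff) (auto simp: in_cbox_complex_iff diag_iff abs_le_iff)
  have b: "closure (cbox (Complex 2 0) (Complex 4 2) - cbox (Complex 2 1) (Complex 3 2)) = tile (Complex 3 1) (Complex (- 1) 1)"
    by (rule closure_cbox_diff) (auto simp: in_cbox_complex_iff diag_iff abs_le_iff)
  have c: "{tile (2 * Complex 1 1 + u) (- u) | u. u \<in> diag - {Complex 1 1}} =
      {tile (Complex 3 1) (Complex (- 1) 1), tile (Complex 1 3) (Complex 1 (- 1)), tile (Complex 1 1) (Complex 1 1)}"
  proof -
    have "diag - {Complex 1 1} = {Complex 1 (- 1), Complex (- 1) 1, Complex (- 1) (- 1)}"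
      by (auto simp: diag_def)
    moreover have "2 * Complex 1 1 + Complex 1 (- 1) = Complex 3 1" "2 * Complex 1 1 + Complex (- 1) 1 = Complex 1 3"
      "2 * Complex 1 1 + Complex (- 1) (- 1) = Complex 1 1" "- Complex 1 (- 1) = Complex (- 1) 1"
      "- Complex (- 1) 1 = Complex 1 (- 1)" "- Complex (- 1) (- 1) = Complex 1 1"
      by (simp_all add: complex_eq_iff)
    moreover have "{tile (2 * Complex 1 1 + u) (- u) | u. u \<in> diag - {Complex 1 1}} =
        (\<lambda>u. tile (2 * Complex 1 1 + u) (- u)) ` (diag - {Complex 1 1})"
      by blast
    ultimately show ?thesis
      by (simp only: image_insert image_empty)
  qed
  have d: "tile (Complex 1 1 + Complex 1 1) (Complex 1 1) = tile (2 * Complex 1 1) (Complex 1 1)"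
    by (simp only: mult_2)
  show ?thesis
    unfolding chair_dissection_def chair_eq_tile translation_tile a b c d by blast
qed

lemma open_quad: "open (quad r u)"
  unfolding quad_def by (intro open_Collect_conj open_Collect_less continuous_intros)

lemma quad_subset_interior:
  assumes "u \<in> diag" "s \<in> diag" "u \<noteq> s"
  shows "quad r u \<subseteq> interior (tile r s)"
  by (rule interior_maximal[OF _ open_quad]) (use assms in \<open>auto simp: quad_def tile_def diag_iff complex_eq_iff\<close>)

lemma mid_quad: "u \<in> diag \<Longrightarrow> r + u / 2 \<in> quad r u"
  by (auto simp: quad_def diag_iff)

section \<open>Children and parents in a fixed tiling\<close>

definition tiles :: "complex set set \<Rightarrow> (complex \<times> complex) set" where
  "tiles \<T> = {(r, s). s \<in> diag \<and> tile r s \<in> \<T>}"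

lemma tilesD: "(r, s) \<in> tiles \<T> \<Longrightarrow> s \<in> diag"
  by (simp add: tiles_def)

locale fixed_chair_tiling =
  fixes \<T> :: "complex set set"
  assumes tiling: "chair_tiling \<T>"
begin

lemma in_tiling: "T \<in> \<T> \<longleftrightarrow> (\<exists>r s. (r, s) \<in> tiles \<T> \<and> T = tile r s)"
proof
  assume T: "T \<in> \<T>"
  then obtain k t where "T = motion k t ` chair"
    using tiling by (auto simp: chair_tiling_def plane_tiling_def chair_tiles_def)
  then have "T = tile (\<i> ^ k * Complex 1 1 + t) (\<i> ^ k * Complex 1 1)"
    by (simp add: motion_chair)
  moreover have "\<i> ^ k * Complex 1 1 \<in> diag"
    unfolding rotation_diag by (simp add: diag_def)
  ultimately show "\<exists>r s. (r, s) \<in> tiles \<T> \<and> T = tile r s"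
    using T unfolding tiles_def by blast
qed (auto simp: tiles_def)

lemma tiles_cover: "\<exists>r s. (r, s) \<in> tiles \<T> \<and> z \<in> tile r s"
proof -
  have "z \<in> \<Union>\<T>" using tiling by (simp add: chair_tiling_def plane_tiling_def)
  then show ?thesis using in_tiling by blast
qed

lemma tiles_disjoint:
  assumes "(r, s) \<in> tiles \<T>" "(r', s') \<in> tiles \<T>" "z \<in> interior (tile r s)" "z \<in> interior (tile r' s')"
  shows "r = r' \<and> s = s'"
proof -
  have "pairwise (\<lambda>S T. disjnt (interior S) (interior T)) \<T>"
    using tiling by (simp add: chair_tiling_def plane_tiling_def)
  then have "tile r s = tile r' s'"
    using assms unfolding pairwise_def disjnt_def tiles_def by blast
  then show ?thesis
    using tile_inject assms tilesD by blast
qed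

lemma quads_disjoint:
  assumes "(r, s) \<in> tiles \<T>" "(r', s') \<in> tiles \<T>" "z \<in> quad r u" "z \<in> quad r' u'"
    "u \<in> diag - {s}" "u' \<in> diag - {s'}"
  shows "r = r' \<and> s = s'"
  using tiles_disjoint[OF assms(1,2)] quad_subset_interior[of u s r] quad_subset_interior[of u' s' r']
    tilesD[OF assms(1)] tilesD[OF assms(2)] assms(3-) by blast

lemma subst_piece:
  assumes "motion k t ` chair = tile p d" "p = \<i> ^ k * Complex 1 1 + t" "d = \<i> ^ k * Complex 1 1"
  shows "motion k (2 * t) ` tile (2 * Complex 1 1) (Complex 1 1) = tile (2 * p) d"
    and "motion k (2 * t) ` tile (2 * Complex 1 1 + u) (- u) = tile (2 * p + \<i> ^ k * u) (- (\<i> ^ k * u))"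
  using assms by (simp_all add: motion_tile algebra_simps)

lemma tiles_children:
  assumes "(p, d) \<in> tiles \<T>"
  shows "(2 * p, d) \<in> tiles \<T>" and "u \<in> diag - {d} \<Longrightarrow> (2 * p + u, - u) \<in> tiles \<T>"
proof -
  obtain k t where k: "motion k t ` chair = tile p d" "p = \<i> ^ k * Complex 1 1 + t" "d = \<i> ^ k * Complex 1 1"
    using tile_eq_motion_chair tilesD[OF assms] .
  have mem: "motion k (2 * t) ` P \<in> \<T>" if "P \<in> chair_dissection" for P
  proof -
    have "motion k t ` chair \<in> \<T>" using k(1) assms by (simp add: tiles_def)
    then have "motion k (2 * t) ` P \<in> chair_subst \<T>" using that unfolding chair_subst_def by blast
    then show ?thesis using tiling by (simp add: chair_tiling_def)
  qed
  show "(2 * p, d) \<in> tiles \<T>"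
    using mem[of "tile (2 * Complex 1 1) (Complex 1 1)"] tilesD[OF assms]
    unfolding subst_piece(1)[OF k] tiles_def chair_dissection_eq by blast
  assume u: "u \<in> diag - {d}"
  \<comment> \<open>The direction \<open>u\<close> turned back to the prototile.\<close>
  define v where "v = u / \<i> ^ k"
  have uv: "u = \<i> ^ k * v" by (simp add: v_def)
  then have "v \<in> diag - {Complex 1 1}"
    using u k(3) rotation_diag[of k v] by auto
  then have "tile (2 * Complex 1 1 + v) (- v) \<in> chair_dissection"
    unfolding chair_dissection_eq by blast
  then have "tile (2 * p + u) (- u) \<in> \<T>"
    using mem[of "tile (2 * Complex 1 1 + v) (- v)"] unfolding subst_piece(2)[OF k] uv[symmetric] by blast
  moreover have "- u \<in> diag" using u by (auto simp: diag_iff)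
  ultimately show "(2 * p + u, - u) \<in> tiles \<T>"
    by (simp add: tiles_def)
qed

lemma tiles_parent:
  assumes "(r, s) \<in> tiles \<T>"
  shows "\<exists>p d. (p, d) \<in> tiles \<T> \<and> (r = 2 * p \<and> s = d \<or> (\<exists>u\<in>diag - {d}. r = 2 * p + u \<and> s = - u))"
proof -
  have "tile r s \<in> chair_subst \<T>"
    using assms tiling by (simp add: tiles_def chair_tiling_def)
  then obtain k t P where P: "tile r s = motion k (2 * t) ` P" "motion k t ` chair \<in> \<T>" "P \<in> chair_dissection"
    unfolding chair_subst_def by blast
  define d where "d = \<i> ^ k * Complex 1 1"
  define p where "p = d + t"
  have d: "d \<in> diag" unfolding d_def rotation_diag by (simp add: diag_def)
  have k: "motion k t ` chair = tile p d" "p = \<i> ^ k * Complex 1 1 + t" "d = \<i> ^ k * Complex 1 1"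
    by (simp_all add: motion_chair p_def d_def)
  have pd: "(p, d) \<in> tiles \<T>" using P(2) k(1) d by (simp add: tiles_def)
  have s: "s \<in> diag" using tilesD[OF assms] .
  from P(3) consider "P = tile (2 * Complex 1 1) (Complex 1 1)"
    | v where "P = tile (2 * Complex 1 1 + v) (- v)" "v \<in> diag - {Complex 1 1}"
    unfolding chair_dissection_eq by blast
  then show ?thesis
  proof cases
    case 1
    then have "tile r s = tile (2 * p) d"
      using P(1) subst_piece(1)[OF k] by simp
    then show ?thesis using tile_inject[OF s d] pd by blast
  next
    case (2 v)
    then have "tile r s = tile (2 * p + \<i> ^ k * v) (- (\<i> ^ k * v))"
      using P(1) subst_piece(2)[OF k] by simp
    moreover have u: "\<i> ^ k * v \<in> diag - {d}"
      using 2(2) rotation_diag[of k v] by (simp add: d_def)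
    moreover have "- (\<i> ^ k * v) \<in> diag" using u by (auto simp: diag_iff)
    ultimately show ?thesis
      using tile_inject[OF s] pd by blast
  qed
qed

end

section \<open>Reflex corners are lattice points\<close>

definition cell_centre :: "int \<Rightarrow> int \<Rightarrow> complex" where
  "cell_centre i j = Complex (of_int i + 1/2) (of_int j + 1/2)"

definition quadrant_of :: "int \<Rightarrow> int \<Rightarrow> int \<Rightarrow> int \<Rightarrow> complex" where
  "quadrant_of p q i j = Complex (if i = p then 1 else - 1) (if j = q then 1 else - 1)"

lemma quadrant_of_diag [simp]: "quadrant_of p q i j \<in> diag"
  by (auto simp: quadrant_of_def diag_iff)

lemma cell_centre_quad:
  "\<lbrakk>i \<in> {p - 1, p}; j \<in> {q - 1, q}\<rbrakk> \<Longrightarrow> cell_centre i j \<in> quad (pt p q) (quadrant_of p q i j)"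
  by (auto simp: cell_centre_def quad_def quadrant_of_def)

context fixed_chair_tiling
begin

text \<open>Two notches exclude at most two of the four directions. In a remaining direction
  \<open>u\<close> both tiles have a unit square, and the centre of one square lies in the
  other.\<close>

lemma tiles_separated:
  assumes "(r, s) \<in> tiles \<T>" "(r', s') \<in> tiles \<T>" "\<bar>Re r - Re r'\<bar> < 1/2" "\<bar>Im r - Im r'\<bar> < 1/2"
  shows "r = r' \<and> s = s'"
proof -
  have "\<exists>u. u \<in> diag \<and> u \<noteq> s \<and> u \<noteq> s'"
  proof -
    have "card {s, s'} < card diag"
      by (simp add: diag_def card_insert_if)
    then show ?thesis
      by (metis card_mono finite.emptyI finite.insertI insertCI linorder_not_less subsetI)
  qed
  then obtain u where u: "u \<in> diag - {s}" "u \<in> diag - {s'}" by blast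
  have "r + u / 2 \<in> quad r u"
    using mid_quad u by blast
  moreover have "Re r - Re r' < 1/2" "Re r' - Re r < 1/2" "Im r - Im r' < 1/2" "Im r' - Im r < 1/2"
    using assms(3,4) by linarith+
  then have "r + u / 2 \<in> quad r' u"
    using u(1) by (auto simp: quad_def diag_iff)
  ultimately show ?thesis
    using quads_disjoint assms(1,2) u by blast
qed

text \<open>By \<open>tiles_separated\<close>, each square of a grid of mesh 1/2 holds at most one
  reflex corner.\<close>

lemma finite_tiles_bounded: "finite {x \<in> tiles \<T>. norm (fst x) \<le> K}"
proof -
  let ?f = "\<lambda>x::complex \<times> complex. (\<lfloor>2 * Re (fst x)\<rfloor>, \<lfloor>2 * Im (fst x)\<rfloor>)"
  have "inj_on ?f {x \<in> tiles \<T>. norm (fst x) \<le> K}"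
  proof (rule inj_onI)
    fix x y assume x: "x \<in> {x \<in> tiles \<T>. norm (fst x) \<le> K}" and y: "y \<in> {x \<in> tiles \<T>. norm (fst x) \<le> K}"
      and "?f x = ?f y"
    then have "\<lfloor>2 * Re (fst x)\<rfloor> = \<lfloor>2 * Re (fst y)\<rfloor>" "\<lfloor>2 * Im (fst x)\<rfloor> = \<lfloor>2 * Im (fst y)\<rfloor>"
      by simp_all
    then have "\<bar>Re (fst x) - Re (fst y)\<bar> < 1/2" "\<bar>Im (fst x) - Im (fst y)\<bar> < 1/2"
      by linarith+
    then have "fst x = fst y \<and> snd x = snd y"
      using x y by (intro tiles_separated) simp_all
    then show "x = y" by (simp add: prod_eq_iff)
  qed
  moreover have "?f ` {x \<in> tiles \<T>. norm (fst x) \<le> K} \<subseteq> {\<lfloor>- 2 * K\<rfloor>..\<lfloor>2 * K\<rfloor>} \<times> {\<lfloor>- 2 * K\<rfloor>..\<lfloor>2 * K\<rfloor>}"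
  proof (rule image_subsetI)
    fix x assume "x \<in> {x \<in> tiles \<T>. norm (fst x) \<le> K}"
    then have "- K \<le> Re (fst x)" "Re (fst x) \<le> K" "- K \<le> Im (fst x)" "Im (fst x) \<le> K"
      using abs_Re_le_cmod[of "fst x"] abs_Im_le_cmod[of "fst x"] by auto
    then show "?f x \<in> {\<lfloor>- 2 * K\<rfloor>..\<lfloor>2 * K\<rfloor>} \<times> {\<lfloor>- 2 * K\<rfloor>..\<lfloor>2 * K\<rfloor>}"
      by (auto intro!: floor_mono)
  qed
  ultimately show ?thesis
    by (rule inj_on_finite) simp
qed

text \<open>The child at \<open>2 * p\<close> has its squares in the same directions as the parent.
  The child at \<open>2 * p + v\<close> lies in the doubled square of the parent in direction
  \<open>v\<close>, of which its reflex corner is the centre.\<close>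

lemma quad_parent:
  assumes rs: "(r, s) \<in> tiles \<T>" and u: "u \<in> diag - {s}" and z: "z \<in> quad r u"
  shows "\<exists>p d w. (p, d) \<in> tiles \<T> \<and> w \<in> diag - {d} \<and> z / 2 \<in> quad p w \<and> (\<exists>v\<in>insert 0 diag. r = 2 * p + v)"
proof -
  obtain p d where pd: "(p, d) \<in> tiles \<T>"
    and "r = 2 * p \<and> s = d \<or> (\<exists>v\<in>diag - {d}. r = 2 * p + v \<and> s = - v)"
    using tiles_parent[OF rs] by blast
  then consider "r = 2 * p" "s = d" | (child) v where "v \<in> diag - {d}" "r = 2 * p + v" "s = - v"
    by blast
  then show ?thesis
  proof cases
    case 1
    then have "z / 2 \<in> quad p u"
      using z by (auto simp: quad_def algebra_simps)
    then show ?thesis using 1 pd u by auto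
  next
    case (child v)
    have "\<not> (Re u = - Re v \<and> Im u = - Im v)"
      using u child by (auto simp: complex_eq_iff)
    then have "z / 2 \<in> quad p v"
      using z child(1,2) u by (auto simp: quad_def diag_iff)
    then show ?thesis using child pd by blast
  qed
qed

text \<open>Follow a point \<open>z\<close> of the tile through the ancestors of the tile: \<open>z / 2 ^ n\<close> lies in the ancestor
  of order \<open>n\<close>. Only finitely many tiles come near the origin, so one unit square of a tile contains
  infinitely many of these points, hence has the origin in its closure and by convexity contains
  \<open>z / 2 ^ Suc N\<close> along with \<open>z / 2 ^ N\<close>. Thus this tile is its own parent, whence \<open>p = 2 p + v\<close> for its
  reflex corner.\<close>

lemma reflex_lattice:
  assumes rs: "(r, s) \<in> tiles \<T>"
  shows "\<exists>m n. r = pt m n"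
proof -
  have s: "s \<in> diag" using tilesD[OF rs] .
  \<comment> \<open>The square opposite to the notch always belongs to the tile; \<open>z\<close> is
    its centre.\<close>
  define z where "z = r + (- s) / 2"
  \<comment> \<open>A state consists of reflex corner, notch direction and the direction of the
    square containing the point; the clause for 0 anchors the chain of ancestors at
    \<open>r\<close>.\<close>
  define P where "P n x \<longleftrightarrow> (fst x, fst (snd x)) \<in> tiles \<T> \<and> snd (snd x) \<in> diag - {fst (snd x)} \<and>
    z / 2 ^ n \<in> quad (fst x) (snd (snd x)) \<and> (n = 0 \<longrightarrow> fst x = r)" for n and x :: "complex \<times> complex \<times> complex"
  define Q where "Q x y \<longleftrightarrow> (\<exists>v\<in>insert 0 diag. fst x = 2 * fst y + v)"
    for x y :: "complex \<times> complex \<times> complex"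
  have "\<exists>f. \<forall>n. P n (f n) \<and> Q (f n) (f (Suc n))"
  proof (rule dependent_nat_choice)
    have "- s \<in> diag - {s}"
      using s by (auto simp: diag_iff complex_eq_iff)
    then have "P 0 (r, s, - s)"
      using rs mid_quad[of "- s" r] by (simp add: P_def z_def)
    then show "\<exists>x. P 0 x" ..
  next
    fix x n assume "P n x"
    then have "\<exists>p d w. (p, d) \<in> tiles \<T> \<and> w \<in> diag - {d} \<and> z / 2 ^ n / 2 \<in> quad p w \<and>
        (\<exists>v\<in>insert 0 diag. fst x = 2 * p + v)"
      unfolding P_def by (intro quad_parent[of "fst x" "fst (snd x)" "snd (snd x)"]) blast+
    then obtain p d w where "(p, d) \<in> tiles \<T>" "w \<in> diag - {d}" "z / 2 ^ n / 2 \<in> quad p w"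
        "\<exists>v\<in>insert 0 diag. fst x = 2 * p + v"
      by blast
    then have "P (Suc n) (p, d, w) \<and> Q x (p, d, w)"
      by (simp add: P_def Q_def divide_divide_eq_left mult.commute)
    then show "\<exists>y. P (Suc n) y \<and> Q x y" ..
  qed
  then obtain f where f: "\<And>n. P n (f n)" and step: "\<And>n. Q (f n) (f (Suc n))"
    by blast
  have lattice_step: "\<exists>m n. 2 * p + v = pt m n" if "p = pt k l" "v \<in> insert 0 diag" for p v k l
  proof -
    have "\<exists>a b. v = pt a b"
    proof (cases "v = 0")
      case True
      then have "v = pt 0 0" by (simp add: complex_eq_iff)
      then show ?thesis by blast
    next
      case False
      then have "v = pt \<lfloor>Re v\<rfloor> \<lfloor>Im v\<rfloor>"
        using that(2) by (auto simp: diag_iff complex_eq_iff)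
      then show ?thesis by blast
    qed
    then obtain a b where "v = pt a b" by blast
    then have "2 * p + v = pt (2 * k + a) (2 * l + b)"
      using that by (simp add: complex_eq_iff)
    then show ?thesis by blast
  qed
  let ?K = "norm z + 2"
  have "finite (range f)"
  proof (rule finite_subset)
    show "range f \<subseteq> (\<lambda>(x, u). (fst x, snd x, u)) ` ({x \<in> tiles \<T>. norm (fst x) \<le> ?K} \<times> diag)"
    proof (rule image_subsetI)
      fix n
      have n: "(fst (f n), fst (snd (f n))) \<in> tiles \<T>" "snd (snd (f n)) \<in> diag"
        "z / 2 ^ n \<in> quad (fst (f n)) (snd (snd (f n)))"
        using f[of n] unfolding P_def by blast+
      let ?d = "z / 2 ^ n - fst (f n)"
      have "\<bar>Re ?d\<bar> \<le> 1" "\<bar>Im ?d\<bar> \<le> 1"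
        using n(2,3) by (auto simp: quad_def diag_iff abs_le_iff)
      then have "norm ?d \<le> 2"
        using cmod_le[of ?d] by linarith
      moreover have "norm (z / 2 ^ n) \<le> norm z"
        by (simp add: norm_divide norm_power divide_le_eq mult_le_cancel_left1)
      moreover have "norm (fst (f n)) \<le> norm (z / 2 ^ n) + norm ?d"
        using norm_triangle_ineq4[of "z / 2 ^ n" ?d] by simp
      ultimately have "norm (fst (f n)) \<le> ?K"
        by linarith
      then show "f n \<in> (\<lambda>(x, u). (fst x, snd x, u)) ` ({x \<in> tiles \<T>. norm (fst x) \<le> ?K} \<times> diag)"
        using n by (intro image_eqI[of _ _ "((fst (f n), fst (snd (f n))), snd (snd (f n)))"]) simp_all
    qed
    show "finite ((\<lambda>(x, u). (fst x, snd x, u)) ` ({x \<in> tiles \<T>. norm (fst x) \<le> ?K} \<times> diag))"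
      using finite_tiles_bounded by (intro finite_imageI finite_cartesian_product) (simp_all add: diag_def)
  qed
  then obtain N where N: "infinite {n. f n = f N}"
    using pigeonhole_infinite[of "UNIV :: nat set" f] by auto
  then obtain \<sigma> :: "nat \<Rightarrow> nat" where \<sigma>: "strict_mono \<sigma>" "\<And>k. f (\<sigma> k) = f N"
    using infinite_enumerate by blast
  define p d w where "p = fst (f N)" and "d = fst (snd (f N))" and "w = snd (snd (f N))"
  have pd: "(p, d) \<in> tiles \<T>" "w \<in> diag - {d}" "z / 2 ^ N \<in> quad p w"
    using f[of N] unfolding P_def p_def d_def w_def by blast+
  let ?C = "{z. 0 \<le> (Re z - Re p) * Re w} \<inter> {z. (Re z - Re p) * Re w \<le> 1} \<inter>
    {z. 0 \<le> (Im z - Im p) * Im w} \<inter> {z. (Im z - Im p) * Im w \<le> 1}"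
  have "0 \<in> ?C"
  proof (rule closed_sequentially)
    show "closed ?C"
      by (intro closed_Int closed_Collect_le continuous_intros)
    show "z / 2 ^ \<sigma> k \<in> ?C" for k
      using f[of "\<sigma> k"] unfolding P_def \<sigma>(2) p_def[symmetric] w_def[symmetric] by (simp add: quad_def)
    have "(\<lambda>n. z * (1 / 2) ^ n) \<longlonglongrightarrow> z * 0"
      by (intro tendsto_intros LIMSEQ_power_zero) (simp add: norm_divide)
    then have "(\<lambda>n. z / 2 ^ n) \<longlonglongrightarrow> 0"
      by (simp add: power_one_over)
    then show "(\<lambda>k. z / 2 ^ \<sigma> k) \<longlonglongrightarrow> 0"
      using LIMSEQ_subseq_LIMSEQ[OF _ \<sigma>(1), of "\<lambda>n. z / 2 ^ n"] by (simp add: o_def)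
  qed
  then have half: "z / 2 ^ N / 2 \<in> quad p w"
    using pd(3) by (auto simp: quad_def algebra_simps)
  have p': "(fst (f (Suc N)), fst (snd (f (Suc N)))) \<in> tiles \<T>"
      "snd (snd (f (Suc N))) \<in> diag - {fst (snd (f (Suc N)))}"
      "z / 2 ^ Suc N \<in> quad (fst (f (Suc N))) (snd (snd (f (Suc N))))"
    using f[of "Suc N"] unfolding P_def by blast+
  have "z / 2 ^ Suc N = z / 2 ^ N / 2"
    by simp
  then have "p = fst (f (Suc N))"
    using quads_disjoint[OF pd(1) p'(1) half _ pd(2) p'(2)] p'(3) by (simp add: mult.commute)
  then obtain v where v: "v \<in> insert 0 diag" "p = 2 * p + v"
    using step[of N] unfolding Q_def p_def by metis
  have "\<exists>m n. p = pt m n"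
  proof -
    have "p = 2 * pt 0 0 + (- v)"
      using v(2) by (simp add: complex_eq_iff)
    moreover have "- v \<in> insert 0 diag"
      using v(1) by (auto simp: diag_iff)
    ultimately show ?thesis using lattice_step[OF refl] by metis
  qed
  \<comment> \<open>Back from the ancestor of order \<open>N\<close> to the tile itself: each
    generation doubles the reflex corner and adds 0 or a diagonal vector.\<close>
  then have "\<exists>m n. fst (f (N - i)) = pt m n" if "i \<le> N" for i
    using that
  proof (induction i)
    case (Suc i)
    then obtain k l where "fst (f (N - i)) = pt k l" by auto
    moreover have "Suc (N - Suc i) = N - i" using Suc by simp
    ultimately show ?case
      using step[of "N - Suc i"] lattice_step unfolding Q_def by metis
  qed (simp add: p_def)
  from this[of N] show ?thesis
    using f[of 0] by (simp add: P_def)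
qed

section \<open>Owners of unit cells\<close>

definition owns :: "int \<Rightarrow> int \<Rightarrow> complex \<Rightarrow> int \<Rightarrow> int \<Rightarrow> bool" where
  "owns p q s i j \<longleftrightarrow> (pt p q, s) \<in> tiles \<T> \<and> i \<in> {p - 1, p} \<and> j \<in> {q - 1, q} \<and> s \<noteq> quadrant_of p q i j"

lemma owns_quad:
  assumes "owns p q s i j"
  shows "cell_centre i j \<in> quad (pt p q) (quadrant_of p q i j)" "quadrant_of p q i j \<in> diag - {s}"
  using assms cell_centre_quad by (auto simp: owns_def)

lemma owns_exists: "\<exists>p q s. owns p q s i j"
proof -
  obtain r s where rs: "(r, s) \<in> tiles \<T>" "cell_centre i j \<in> tile r s"
    using tiles_cover by blast
  then obtain p q where r: "r = pt p q" using reflex_lattice by blast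
  have *: "i \<in> {p - 1, p}" if "\<bar>of_int i + 1/2 - of_int p\<bar> \<le> (1::real)" for i p :: int
  proof -
    have "of_int p < (of_int (i + 2) :: real)" "of_int i < (of_int (p + 1) :: real)"
      using that by (auto simp: abs_le_iff)
    then have "p < i + 2" "i < p + 1" unfolding of_int_less_iff .
    then show ?thesis by auto
  qed
  have ij: "i \<in> {p - 1, p}" "j \<in> {q - 1, q}"
    using rs(2) *[of i p] *[of j q] by (simp_all add: r tile_def cell_centre_def)
  moreover have "s \<noteq> quadrant_of p q i j"
    using cell_centre_quad[OF ij] rs(2) by (auto simp: r tile_def quad_def)
  ultimately show ?thesis using rs(1) r unfolding owns_def by blast
qed

text \<open>The centre of the cell lies in an open square of each owner.\<close>

lemma owns_unique: "\<lbrakk>owns p q s i j; owns p' q' s' i j\<rbrakk> \<Longrightarrow> p = p' \<and> q = q' \<and> s = s'"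
  using quads_disjoint[of "pt p q" s "pt p' q'" s' "cell_centre i j"] owns_quad[of p q s i j] owns_quad[of p' q' s' i j]
  by (auto simp: owns_def)

lemma notch_direction_unique: "\<lbrakk>(r, s) \<in> tiles \<T>; (r, s') \<in> tiles \<T>\<rbrakk> \<Longrightarrow> s = s'"
  using tiles_separated[of r s r s'] by simp

definition own :: "int \<Rightarrow> int \<Rightarrow> int \<times> int" where
  "own i j = (SOME x. \<exists>s. owns (fst x) (snd x) s i j)"

lemma own_iff: "own i j = (p, q) \<longleftrightarrow> (\<exists>s. owns p q s i j)"
proof -
  obtain p' q' s' where o: "owns p' q' s' i j" using owns_exists by blast
  have "\<exists>s. owns (fst (own i j)) (snd (own i j)) s i j"
    unfolding own_def by (rule someI[of _ "(p', q')"]) (use o in auto)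
  then show ?thesis
    using owns_unique by (metis fst_conv snd_conv surjective_pairing)
qed

lemma ownE:
  obtains p q s where "own i j = (p, q)" "owns p q s i j"
  using own_iff owns_exists by metis

lemma own_eqI: "owns p q s i j \<Longrightarrow> own i j = (p, q)"
  using own_iff by blast

lemma chair_cells_own: "chair_cells own"
proof
  fix i j
  obtain p q s where o: "own i j = (p, q)" "owns p q s i j" by (rule ownE)
  then show "own i j \<in> {i, i + 1} \<times> {j, j + 1}"
    by (auto simp: owns_def)
next
  fix i j p q assume "own i j = (p, q)"
  then obtain s where "(pt p q, s) \<in> tiles \<T>" by (auto simp: own_iff owns_def)
  \<comment> \<open>A reflex corner is twice a lattice point, possibly shifted by a vector with both
    coordinates odd, so its own coordinates have equal parity.\<close>
  then obtain p' d where "(p', d) \<in> tiles \<T>" "pt p q = 2 * p' \<or> (\<exists>u\<in>diag. pt p q = 2 * p' + u)"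
    using tiles_parent by blast
  then obtain k l where "pt p q = 2 * pt k l \<or> (\<exists>u\<in>diag. pt p q = 2 * pt k l + u)"
    using reflex_lattice by blast
  moreover have "p = 2 * k \<and> q = 2 * l" if "pt p q = 2 * pt k l"
    using that by (simp add: complex_eq_iff)
  moreover have "\<exists>a\<in>{1, - 1}. \<exists>b\<in>{1, - 1}. p = 2 * k + a \<and> q = 2 * l + b" if u: "pt p q = 2 * pt k l + u" "u \<in> diag" for u
  proof -
    have "\<exists>a\<in>{1, - 1 :: int}. Re u = of_int a" "\<exists>b\<in>{1, - 1 :: int}. Im u = of_int b"
      using u(2) by (auto simp: diag_iff)
    then obtain a b :: int where ab: "a \<in> {1, - 1}" "b \<in> {1, - 1}" "Re u = of_int a" "Im u = of_int b"
      by blast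
    then have "of_int p = (of_int (2 * k + a) :: real)" "of_int q = (of_int (2 * l + b) :: real)"
      using u(1) by (simp_all add: complex_eq_iff)
    then show ?thesis using ab(1,2) unfolding of_int_eq_iff by blast
  qed
  ultimately show "even (p + q)" by fastforce
next
  fix i j p q assume "own i j = (p, q)"
  then obtain s where s: "(pt p q, s) \<in> tiles \<T>" by (auto simp: own_iff owns_def)
  have own: "own k l = (p, q) \<longleftrightarrow> s \<noteq> quadrant_of p q k l" if "k \<in> {p - 1, p}" "l \<in> {q - 1, q}" for k l
    using that s notch_direction_unique[OF s] unfolding own_iff owns_def by blast
  have "s \<in> diag" using tilesD[OF s] .
  show "\<exists>a\<in>{p - 1, p}. \<exists>b\<in>{q - 1, q}. \<forall>k\<in>{p - 1, p}. \<forall>l\<in>{q - 1, q}. (own k l = (p, q)) = ((k, l) \<noteq> (a, b))"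
  proof (intro bexI ballI)
    fix k l assume kl: "k \<in> {p - 1, p}" "l \<in> {q - 1, q}"
    show "(own k l = (p, q)) = ((k, l) \<noteq> (if Re s = 1 then p else p - 1, if Im s = 1 then q else q - 1))"
      unfolding own[OF kl] using kl \<open>s \<in> diag\<close> by (auto simp: quadrant_of_def diag_iff complex_eq_iff)
  qed auto
next
  fix \<alpha> \<beta> i j :: int assume ab: "\<alpha> \<in> {0, 1}" "\<beta> \<in> {0, 1}"
  obtain p q s where o: "own i j = (p, q)" "owns p q s i j" by (rule ownE)
  have pq: "(pt p q, s) \<in> tiles \<T>" "i \<in> {p - 1, p}" "j \<in> {q - 1, q}" "s \<noteq> quadrant_of p q i j"
    using o(2) by (auto simp: owns_def)
  show "own (2 * i + \<alpha>) (2 * j + \<beta>) =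
      (if own i j = (i + \<alpha>, j + \<beta>) then (2 * (i + \<alpha>), 2 * (j + \<beta>)) else (2 * i + 1, 2 * j + 1))"
  \<comment> \<open>The fine cell touching the doubled reflex corner of the owner stays with the
    doubled tile; the other three cells of the block go to the child whose reflex corner is the
    centre of the block.\<close>
  proof (cases "own i j = (i + \<alpha>, j + \<beta>)")
    case True
    then have "p = i + \<alpha>" "q = j + \<beta>" using o(1) by auto
    moreover have "2 * pt p q = pt (2 * p) (2 * q)"
      by (simp add: complex_eq_iff)
    then have "(pt (2 * p) (2 * q), s) \<in> tiles \<T>"
      using tiles_children(1)[OF pq(1)] by simp
    ultimately have "owns (2 * p) (2 * q) s (2 * i + \<alpha>) (2 * j + \<beta>)"
      using pq(4) ab by (auto simp: owns_def quadrant_of_def)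
    then show ?thesis
      using own_eqI True \<open>p = i + \<alpha>\<close> \<open>q = j + \<beta>\<close> by simp
  next
    case False
    let ?u = "quadrant_of p q i j"
    have "(2 * pt p q + ?u, - ?u) \<in> tiles \<T>"
      using tiles_children(2)[OF pq(1), of ?u] pq(4) by simp
    moreover have "2 * pt p q + ?u = pt (2 * i + 1) (2 * j + 1)"
      using pq(2,3) by (auto simp: quadrant_of_def complex_eq_iff)
    ultimately have "(pt (2 * i + 1) (2 * j + 1), - ?u) \<in> tiles \<T>" by simp
    moreover have "- ?u \<noteq> quadrant_of (2 * i + 1) (2 * j + 1) (2 * i + \<alpha>) (2 * j + \<beta>)"
      using False ab pq(2,3) o(1) by (auto simp: quadrant_of_def complex_eq_iff)
    ultimately have "owns (2 * i + 1) (2 * j + 1) (- ?u) (2 * i + \<alpha>) (2 * j + \<beta>)"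
      using ab by (auto simp: owns_def)
    then show ?thesis
      using own_eqI False by simp
  qed
qed

end

section \<open>Skeleton and vertices\<close>

definition cell :: "int \<Rightarrow> int \<Rightarrow> complex set" where
  "cell i j = cbox (pt i j) (pt (i + 1) (j + 1))"

lemma in_cell: "z \<in> cell i j \<longleftrightarrow>
    of_int i \<le> Re z \<and> Re z \<le> of_int i + 1 \<and> of_int j \<le> Im z \<and> Im z \<le> of_int j + 1"
  by (auto simp: cell_def in_cbox_complex_iff)

lemma cells_cover: "z \<in> cell \<lfloor>Re z\<rfloor> \<lfloor>Im z\<rfloor>"
  unfolding in_cell by linarith

lemma cells_meet:
  assumes "z \<in> cell i j" "z \<in> cell k l"
  shows "k \<in> {i - 1, i, i + 1}" "l \<in> {j - 1, j, j + 1}"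
proof -
  have "of_int i \<le> (of_int (k + 1) :: real)" "of_int k \<le> (of_int (i + 1) :: real)"
      "of_int j \<le> (of_int (l + 1) :: real)" "of_int l \<le> (of_int (j + 1) :: real)"
    using assms by (auto simp: in_cell)
  then show "k \<in> {i - 1, i, i + 1}" "l \<in> {j - 1, j, j + 1}"
    unfolding of_int_le_iff by auto
qed

lemma closed_UN_cell: "closed (\<Union>x\<in>I. cell (fst x) (snd x))"
proof (rule closed_locally_finite_UN)
  fix x :: complex and K :: real
  show "finite {i \<in> I. cell (fst i) (snd i) \<inter> cball x K \<noteq> {}}"
  proof (rule finite_near_lattice[where f = fst and g = snd])
    show "finite {i \<in> I. fst i = m \<and> snd i = n}" for m n
      by (rule finite_subset[of _ "{(m, n)}"]) auto
  qed (auto simp: in_cell)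
qed (simp add: cell_def closed_cbox)

lemma cell_subset_closure_quad:
  assumes "i \<in> {p - 1, p}" "j \<in> {q - 1, q}"
  shows "cell i j \<subseteq> closure (quad (pt p q) (quadrant_of p q i j))"
proof -
  have "box (pt i j) (pt (i + 1) (j + 1)) \<noteq> {}"
    by (simp add: box_ne_empty Basis_complex_def)
  then have "closure (box (pt i j) (pt (i + 1) (j + 1))) = cell i j"
    unfolding cell_def by (rule closure_box)
  moreover have "box (pt i j) (pt (i + 1) (j + 1)) \<subseteq> quad (pt p q) (quadrant_of p q i j)"
    using assms by (auto simp: in_box_complex_iff quad_def quadrant_of_def)
  ultimately show ?thesis
    using closure_mono by metis
qed

context fixed_chair_tiling
begin

interpretation cells: chair_cells own
  by (rule chair_cells_own)

lemma owned_cell_subset: "owns p q s i j \<Longrightarrow> cell i j \<subseteq> tile (pt p q) s"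
  using tilesD[of "pt p q" s] by (auto simp: owns_def tile_def in_cell quadrant_of_def diag_iff complex_eq_iff)

text \<open>A point of the tile avoids the missing quarter because of one of its coordinates. That
  coordinate fixes one index of the cell, the position of the point gives the other.\<close>

lemma tile_covered:
  assumes rs: "(pt p q, s) \<in> tiles \<T>" and z: "z \<in> tile (pt p q) s"
  shows "\<exists>i j. owns p q s i j \<and> z \<in> cell i j"
proof -
  have s: "s \<in> diag" using tilesD[OF rs] .
  have b: "Re z \<le> of_int p + 1" "of_int p - 1 \<le> Re z" "Im z \<le> of_int q + 1" "of_int q - 1 \<le> Im z"
    and "(Re z - of_int p) * Re s \<le> 0 \<or> (Im z - of_int q) * Im s \<le> 0"
    using z by (auto simp: tile_def abs_le_iff not_less)
  then have n: "Re s = 1 \<and> Re z \<le> of_int p \<or> Re s = - 1 \<and> Re z \<ge> of_int p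
      \<or> Im s = 1 \<and> Im z \<le> of_int q \<or> Im s = - 1 \<and> Im z \<ge> of_int q"
    using s unfolding diag_iff by auto
  have c: "z \<in> cell i j" if "i \<in> {p - 1, p}" "j \<in> {q - 1, q}" "if i = p then of_int p \<le> Re z else Re z \<le> of_int p"
    "if j = q then of_int q \<le> Im z else Im z \<le> of_int q" for i j
    using that b by (auto simp: in_cell split: if_splits)
  show ?thesis
  proof -
    consider "Re s = 1" "Re z \<le> of_int p" | "Re s = - 1" "Re z \<ge> of_int p"
      | "Im s = 1" "Im z \<le> of_int q" | "Im s = - 1" "Im z \<ge> of_int q"
      using n by blast
    then have "\<exists>i\<in>{p - 1, p}. \<exists>j\<in>{q - 1, q}. (if i = p then of_int p \<le> Re z else Re z \<le> of_int p) \<and>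
        (if j = q then of_int q \<le> Im z else Im z \<le> of_int q) \<and> s \<noteq> quadrant_of p q i j"
    proof cases
      case 1
      then show ?thesis
        by (intro bexI[of _ "p - 1"] bexI[of _ "if of_int q \<le> Im z then q else q - 1"])
          (auto simp: quadrant_of_def complex_eq_iff)
    next
      case 2
      then show ?thesis
        by (intro bexI[of _ p] bexI[of _ "if of_int q \<le> Im z then q else q - 1"])
          (auto simp: quadrant_of_def complex_eq_iff)
    next
      case 3
      then show ?thesis
        by (intro bexI[of _ "if of_int p \<le> Re z then p else p - 1"] bexI[of _ "q - 1"])
          (auto simp: quadrant_of_def complex_eq_iff)
    next
      case 4
      then show ?thesis
        by (intro bexI[of _ "if of_int p \<le> Re z then p else p - 1"] bexI[of _ q])
          (auto simp: quadrant_of_def complex_eq_iff)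
    qed
    then obtain i j where ij: "i \<in> {p - 1, p}" "j \<in> {q - 1, q}" "if i = p then of_int p \<le> Re z else Re z \<le> of_int p"
        "if j = q then of_int q \<le> Im z else Im z \<le> of_int q" "s \<noteq> quadrant_of p q i j"
      by blast
    then have "owns p q s i j" using rs by (simp add: owns_def)
    then show ?thesis using c[OF ij(1-4)] by blast
  qed
qed

text \<open>If all cells at \<open>z\<close> have one owner, removing all cells of other tiles
  leaves an open neighbourhood of \<open>z\<close> inside that tile. Conversely, a cell of a second
  tile puts \<open>z\<close> in the closure of an open square of that tile, which rules out an
  interior point of the first.\<close>

lemma skeleton_iff: "z \<in> skeleton \<T> \<longleftrightarrow> (\<exists>i j k l. z \<in> cell i j \<and> z \<in> cell k l \<and> own i j \<noteq> own k l)"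
proof
  assume "z \<in> skeleton \<T>"
  then obtain T where T: "T \<in> \<T>" "z \<in> frontier T" unfolding skeleton_def by blast
  obtain r s where "(r, s) \<in> tiles \<T>" "T = tile r s"
    using T(1) unfolding in_tiling by blast
  then have rs: "(r, s) \<in> tiles \<T>" "z \<in> frontier (tile r s)"
    using T(2) by simp_all
  then obtain p q where r: "r = pt p q" using reflex_lattice by blast
  have z: "z \<in> tile (pt p q) s" "z \<notin> interior (tile (pt p q) s)"
    using rs(2) closed_tile by (auto simp: frontier_def r closure_closed)
  then obtain i j where ij: "owns p q s i j" "z \<in> cell i j"
    using tile_covered rs(1) r by blast
  let ?C = "\<Union>x\<in>{x. own (fst x) (snd x) \<noteq> (p, q)}. cell (fst x) (snd x)"
  have "z \<in> ?C"
  proof (rule ccontr)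
    assume "z \<notin> ?C"
    have "- ?C \<subseteq> tile (pt p q) s"
    proof
      fix w assume w: "w \<in> - ?C"
      let ?i = "\<lfloor>Re w\<rfloor>" and ?j = "\<lfloor>Im w\<rfloor>"
      have "own ?i ?j = (p, q)"
        using w cells_cover[of w] by auto
      then obtain s' where "owns p q s' ?i ?j" using own_iff by blast
      then have "owns p q s ?i ?j"
        using notch_direction_unique rs(1) r by (metis owns_def)
      then show "w \<in> tile (pt p q) s"
        using owned_cell_subset cells_cover by blast
    qed
    moreover have "open (- ?C)"
      using closed_UN_cell by blast
    ultimately have "- ?C \<subseteq> interior (tile (pt p q) s)"
      by (rule interior_maximal)
    then show False using \<open>z \<notin> ?C\<close> z(2) by blast
  qed
  then obtain k l where "z \<in> cell k l" "own k l \<noteq> (p, q)" by auto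
  then show "\<exists>i j k l. z \<in> cell i j \<and> z \<in> cell k l \<and> own i j \<noteq> own k l"
    using ij own_eqI[OF ij(1)] by metis
next
  assume "\<exists>i j k l. z \<in> cell i j \<and> z \<in> cell k l \<and> own i j \<noteq> own k l"
  then obtain i j k l where z: "z \<in> cell i j" "z \<in> cell k l" "own i j \<noteq> own k l" by blast
  obtain p q s where o: "own i j = (p, q)" "owns p q s i j" by (rule ownE)
  obtain p' q' s' where o': "own k l = (p', q')" "owns p' q' s' k l" by (rule ownE)
  have "z \<notin> interior (tile (pt p q) s)"
  proof
    assume "z \<in> interior (tile (pt p q) s)"
    moreover have "z \<in> closure (quad (pt p' q') (quadrant_of p' q' k l))"
      using cell_subset_closure_quad[of k p' l q'] o'(2) z(2) unfolding owns_def by blast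
    ultimately obtain w where "w \<in> interior (tile (pt p q) s)" "w \<in> quad (pt p' q') (quadrant_of p' q' k l)"
      using open_Int_closure_eq_empty[OF open_interior] by blast
    moreover have "quad (pt p' q') (quadrant_of p' q' k l) \<subseteq> interior (tile (pt p' q') s')"
      using o'(2) tilesD by (intro quad_subset_interior) (auto simp: owns_def)
    ultimately have "pt p q = pt p' q'"
      using tiles_disjoint[of "pt p q" s "pt p' q'" s' w] o(2) o'(2) by (auto simp: owns_def)
    then show False using z(3) o(1) o'(1) by simp
  qed
  moreover have "z \<in> tile (pt p q) s" using owned_cell_subset[OF o(2)] z(1) by blast
  ultimately have "z \<in> frontier (tile (pt p q) s)"
    using closed_tile by (simp add: frontier_def closure_closed)
  moreover have "tile (pt p q) s \<in> \<T>" using o(2) by (simp add: owns_def tiles_def)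
  ultimately show "z \<in> skeleton \<T>" unfolding skeleton_def by blast
qed

lemma row_segment:
  assumes "z \<in> cell i j" "z \<in> cell k j" "own i j \<noteq> own k j"
  shows "\<exists>m n. cells.vE m n \<and> z \<in> seg (False, m, n)"
proof -
  have "k = i - 1 \<or> k = i + 1"
    using cells_meet(1)[OF assms(1,2)] assms(3) by auto
  then show ?thesis
  proof
    assume k: "k = i - 1"
    have "cells.vE i j \<and> z \<in> seg (False, i, j)"
      using assms unfolding k by (auto simp: cells.vE_def in_cell seg_def)
    then show ?thesis by blast
  next
    assume k: "k = i + 1"
    have "cells.vE (i + 1) j \<and> z \<in> seg (False, i + 1, j)"
      using assms unfolding k by (auto simp: cells.vE_def in_cell seg_def)
    then show ?thesis by blast
  qed
qed

lemma column_segment: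
  assumes "z \<in> cell i j" "z \<in> cell i l" "own i j \<noteq> own i l"
  shows "\<exists>m n. cells.hE m n \<and> z \<in> seg (True, m, n)"
proof -
  have "l = j - 1 \<or> l = j + 1"
    using cells_meet(2)[OF assms(1,2)] assms(3) by auto
  then show ?thesis
  proof
    assume l: "l = j - 1"
    have "cells.hE i j \<and> z \<in> seg (True, i, j)"
      using assms unfolding l by (auto simp: cells.hE_def in_cell seg_def)
    then show ?thesis by blast
  next
    assume l: "l = j + 1"
    have "cells.hE i (j + 1) \<and> z \<in> seg (True, i, j + 1)"
      using assms unfolding l by (auto simp: cells.hE_def in_cell seg_def)
    then show ?thesis by blast
  qed
qed

lemma skeleton_segments:
  "skeleton \<T> = (\<Union>s\<in>{(h, m, n). if h then cells.hE m n else cells.vE m n}. seg s)"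
proof (intro set_eqI iffI)
  fix z assume "z \<in> skeleton \<T>"
  then obtain i j k l where z: "z \<in> cell i j" "z \<in> cell k l" "own i j \<noteq> own k l"
    using skeleton_iff by blast
  \<comment> \<open>Cells are products of intervals, so \<open>z\<close> also lies in the cell
    \<open>(k, j)\<close>, and the owner changes either within row \<open>j\<close> or within column
    \<open>k\<close>.\<close>
  have kj: "z \<in> cell k j" using z(1,2) by (simp add: in_cell)
  consider m n where "cells.vE m n" "z \<in> seg (False, m, n)" | m n where "cells.hE m n" "z \<in> seg (True, m, n)"
    using row_segment[OF z(1) kj] column_segment[OF kj z(2)] z(3) by metis
  then show "z \<in> (\<Union>s\<in>{(h, m, n). if h then cells.hE m n else cells.vE m n}. seg s)"
  proof cases
    case (1 m n)
    then show ?thesis by (intro UN_I[of "(False, m, n)"]) simp_all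
  next
    case (2 m n)
    then show ?thesis by (intro UN_I[of "(True, m, n)"]) simp_all
  qed
next
  fix z assume "z \<in> (\<Union>s\<in>{(h, m, n). if h then cells.hE m n else cells.vE m n}. seg s)"
  then obtain h m n where z: "if h then cells.hE m n else cells.vE m n" "z \<in> seg (h, m, n)" by auto
  show "z \<in> skeleton \<T>"
  proof (cases h)
    case True
    then have "z \<in> cell m n" "z \<in> cell m (n - 1)" "own m n \<noteq> own m (n - 1)"
      using z by (auto simp: in_cell seg_def cells.hE_def)
    then show ?thesis using skeleton_iff by blast
  next
    case False
    then have "z \<in> cell m n" "z \<in> cell (m - 1) n" "own m n \<noteq> own (m - 1) n"
      using z by (auto simp: in_cell seg_def cells.vE_def)
    then show ?thesis using skeleton_iff by blast
  qed
qed

end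

section \<open>Marked points of tiles as lattice points\<close>

lemma imaginary_unit_power_cases:
  obtains "\<i> ^ k = 1" | "\<i> ^ k = \<i>" | "\<i> ^ k = - 1" | "\<i> ^ k = - \<i>"
proof -
  have "\<i> ^ k \<in> {1, \<i>, - 1, - \<i>}"
    by (induction k) auto
  then show thesis using that by blast
qed

lemma imaginary_unit_power_pt: "\<exists>m n. \<i> ^ k * pt a b = pt m n"
proof (cases k rule: imaginary_unit_power_cases)
  case 1
  then show ?thesis by auto
next
  case 2
  then have "\<i> ^ k * pt a b = pt (- b) a" by (simp add: complex_eq_iff)
  then show ?thesis by blast
next
  case 3
  then have "\<i> ^ k * pt a b = pt (- a) (- b)" by (simp add: complex_eq_iff)
  then show ?thesis by blast
next
  case 4
  then have "\<i> ^ k * pt a b = pt b (- a)" by (simp add: complex_eq_iff)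
  then show ?thesis by blast
qed

text \<open>Here \<open>x\<close> is an offset from the reflex corner, turned back to the prototile
  with reflex corner \<open>Complex 1 1\<close>; \<open>cnj\<close> inverts the rotation. The nine
  offsets except the one at the notch yield the eight marked points.\<close>

lemma rotated_back_in_all:
  assumes k: "s = \<i> ^ k * Complex 1 1" and "Re x = - 1 \<or> Re x = 0 \<or> Re x = 1" "Im x = - 1 \<or> Im x = 0 \<or> Im x = 1"
    and "\<not> (Re x = Re s \<and> Im x = Im s)"
  shows "Complex 1 1 + cnj (\<i> ^ k) * x \<in> {Complex 0 0, Complex 1 0, Complex 2 0, Complex 2 1,
     Complex 1 1, Complex 1 2, Complex 0 2, Complex 0 1}"
proof (cases k rule: imaginary_unit_power_cases)
  case 1
  then have "Re s = 1" "Im s = 1"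
    using k by simp_all
  moreover have "Complex 1 1 + cnj (\<i> ^ k) * x = Complex (1 + Re x) (1 + Im x)"
    unfolding 1 by (simp add: complex_eq_iff)
  ultimately show ?thesis
    using assms(2-) by (elim disjE conjE) simp_all
next
  case 2
  then have "Re s = - 1" "Im s = 1"
    using k by simp_all
  moreover have "Complex 1 1 + cnj (\<i> ^ k) * x = Complex (1 + Im x) (1 - Re x)"
    unfolding 2 by (simp add: complex_eq_iff)
  ultimately show ?thesis
    using assms(2-) by (elim disjE conjE) simp_all
next
  case 3
  then have "Re s = - 1" "Im s = - 1"
    using k by simp_all
  moreover have "Complex 1 1 + cnj (\<i> ^ k) * x = Complex (1 - Re x) (1 - Im x)"
    unfolding 3 by (simp add: complex_eq_iff)
  ultimately show ?thesis
    using assms(2-) by (elim disjE conjE) simp_all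
next
  case 4
  then have "Re s = 1" "Im s = - 1"
    using k by simp_all
  moreover have "Complex 1 1 + cnj (\<i> ^ k) * x = Complex (1 - Im x) (1 + Re x)"
    unfolding 4 by (simp add: complex_eq_iff)
  ultimately show ?thesis
    using assms(2-) by (elim disjE conjE) simp_all
qed

text \<open>The offsets of the right-angled corners: the reflex corner, the three corners of the
  square that lie in the tile, and the far ends of the two notch sides.\<close>

lemma rotated_back_in_corner:
  assumes k: "s = \<i> ^ k * Complex 1 1"
    and "Re x = 0 \<and> Im x = 0 \<or> (Re x = 1 \<or> Re x = - 1) \<and> (Im x = 1 \<or> Im x = - 1) \<and> \<not> (Re x = Re s \<and> Im x = Im s)
      \<or> Re x = Re s \<and> Im x = 0 \<or> Re x = 0 \<and> Im x = Im s"
  shows "Complex 1 1 + cnj (\<i> ^ k) * x \<in> {Complex 0 0, Complex 2 0, Complex 2 1, Complex 1 1, Complex 1 2, Complex 0 2}"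
proof (cases k rule: imaginary_unit_power_cases)
  case 1
  then have "Re s = 1" "Im s = 1"
    using k by simp_all
  moreover have "Complex 1 1 + cnj (\<i> ^ k) * x = Complex (1 + Re x) (1 + Im x)"
    unfolding 1 by (simp add: complex_eq_iff)
  ultimately show ?thesis
    using assms(2) by (elim disjE conjE) simp_all
next
  case 2
  then have "Re s = - 1" "Im s = 1"
    using k by simp_all
  moreover have "Complex 1 1 + cnj (\<i> ^ k) * x = Complex (1 + Im x) (1 - Re x)"
    unfolding 2 by (simp add: complex_eq_iff)
  ultimately show ?thesis
    using assms(2) by (elim disjE conjE) simp_all
next
  case 3
  then have "Re s = - 1" "Im s = - 1"
    using k by simp_all
  moreover have "Complex 1 1 + cnj (\<i> ^ k) * x = Complex (1 - Re x) (1 - Im x)"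
    unfolding 3 by (simp add: complex_eq_iff)
  ultimately show ?thesis
    using assms(2) by (elim disjE conjE) simp_all
next
  case 4
  then have "Re s = 1" "Im s = - 1"
    using k by simp_all
  moreover have "Complex 1 1 + cnj (\<i> ^ k) * x = Complex (1 - Im x) (1 + Re x)"
    unfolding 4 by (simp add: complex_eq_iff)
  ultimately show ?thesis
    using assms(2) by (elim disjE conjE) simp_all
qed

context fixed_chair_tiling
begin

interpretation chair_graph own \<T>
  using chair_cells_own skeleton_segments by (simp add: chair_graph_def chair_graph_axioms_def)

lemma marked_pointI:
  assumes "(r, s) \<in> tiles \<T>" "s = \<i> ^ k * Complex 1 1" "Complex 1 1 + cnj (\<i> ^ k) * x \<in> P"
  shows "r + x \<in> marked_points P \<T>"
proof -
  have "\<i> ^ k * cnj (\<i> ^ k) = 1"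
    by (cases k rule: imaginary_unit_power_cases) simp_all
  then have "\<i> ^ k * (cnj (\<i> ^ k) * x) = x"
    unfolding mult.assoc[symmetric] by simp
  then have "r + x = motion k (r - s) (Complex 1 1 + cnj (\<i> ^ k) * x)"
    using assms(2) by (simp only: motion_def distrib_left) (simp add: algebra_simps)
  moreover have "motion k (r - s) ` chair \<in> \<T>"
    using assms(1,2) by (simp add: motion_chair tiles_def)
  ultimately show ?thesis
    using assms(3) unfolding marked_points_def by blast
qed

lemma in_all_vertices:
  assumes "(r, s) \<in> tiles \<T>" "Re x = - 1 \<or> Re x = 0 \<or> Re x = 1" "Im x = - 1 \<or> Im x = 0 \<or> Im x = 1"
    and "x \<noteq> s"
  shows "r + x \<in> all_vertices \<T>"
proof -
  obtain k where k: "s = \<i> ^ k * Complex 1 1"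
    using diag_rotations tilesD[OF assms(1)] by blast
  have "\<not> (Re x = Re s \<and> Im x = Im s)"
    using assms(4) by (simp add: complex_eq_iff)
  then show ?thesis
    unfolding all_vertices_def
    by (rule marked_pointI[OF assms(1) k rotated_back_in_all[OF k assms(2,3)]])
qed

lemma in_corner_vertices:
  assumes "(r, s) \<in> tiles \<T>"
    and "x = 0 \<or> x \<in> diag - {s} \<or> x = Complex (Re s) 0 \<or> x = Complex 0 (Im s)"
  shows "r + x \<in> corner_vertices \<T>"
proof -
  obtain k where k: "s = \<i> ^ k * Complex 1 1"
    using diag_rotations tilesD[OF assms(1)] by blast
  have "Re x = 0 \<and> Im x = 0 \<or> (Re x = 1 \<or> Re x = - 1) \<and> (Im x = 1 \<or> Im x = - 1) \<and> \<not> (Re x = Re s \<and> Im x = Im s)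
      \<or> Re x = Re s \<and> Im x = 0 \<or> Re x = 0 \<and> Im x = Im s"
    using assms(2) by (auto simp: diag_iff complex_eq_iff)
  then show ?thesis
    unfolding corner_vertices_def
    by (rule marked_pointI[OF assms(1) k rotated_back_in_corner[OF k]])
qed

lemma all_vertices_eq: "all_vertices \<T> = {v. \<exists>m n. v = pt m n}"
proof (intro set_eqI iffI)
  fix v assume "v \<in> all_vertices \<T>"
  then obtain k t z where v: "v = motion k t z" "motion k t ` chair \<in> \<T>"
    and "z \<in> {Complex 0 0, Complex 1 0, Complex 2 0, Complex 2 1, Complex 1 1, Complex 1 2, Complex 0 2, Complex 0 1}"
    unfolding all_vertices_def marked_points_def by blast
  then have "z \<in> {pt 0 0, pt 1 0, pt 2 0, pt 2 1, pt 1 1, pt 1 2, pt 0 2, pt 0 1}"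
    by (simp add: pt_def)
  then obtain a b where z: "z = pt a b" by blast
  have "\<i> ^ k * Complex 1 1 \<in> diag"
    unfolding rotation_diag by (simp add: diag_def)
  then have "(\<i> ^ k * Complex 1 1 + t, \<i> ^ k * Complex 1 1) \<in> tiles \<T>"
    using v(2) by (simp add: tiles_def motion_chair)
  then obtain p q where pq: "\<i> ^ k * Complex 1 1 + t = pt p q"
    using reflex_lattice by blast
  obtain m n where mn: "\<i> ^ k * pt (a - 1) (b - 1) = pt m n"
    using imaginary_unit_power_pt by blast
  have "pt a b = Complex 1 1 + pt (a - 1) (b - 1)"
    by (simp add: complex_eq_iff)
  then have "v = pt p q + pt m n"
    unfolding v(1) z motion_def pq[symmetric] mn[symmetric] by (simp add: distrib_left)
  then have "v = pt (p + m) (q + n)"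
    by (simp add: complex_eq_iff)
  then show "v \<in> {v. \<exists>m n. v = pt m n}" by blast
next
  fix v assume "v \<in> {v. \<exists>m n. v = pt m n}"
  then obtain m n where v: "v = pt m n" by blast
  obtain p q s where o: "owns p q s m n" by (rule ownE)
  \<comment> \<open>The lower left corner of a cell is marked for the owner of the cell: the offset
    could equal \<open>s\<close> only if the cell filled the missing quarter.\<close>
  have "pt p q + pt (m - p) (n - q) \<in> all_vertices \<T>"
  proof (rule in_all_vertices)
    show "(pt p q, s) \<in> tiles \<T>" using o by (simp add: owns_def)
    show "Re (pt (m - p) (n - q)) = - 1 \<or> Re (pt (m - p) (n - q)) = 0 \<or> Re (pt (m - p) (n - q)) = 1"
      "Im (pt (m - p) (n - q)) = - 1 \<or> Im (pt (m - p) (n - q)) = 0 \<or> Im (pt (m - p) (n - q)) = 1"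
      using o by (auto simp: owns_def)
    show "pt (m - p) (n - q) \<noteq> s"
      using o tilesD[of "pt p q" s] by (auto simp: owns_def quadrant_of_def complex_eq_iff diag_iff)
  qed
  moreover have "pt p q + pt (m - p) (n - q) = v"
    by (simp add: v complex_eq_iff)
  ultimately show "v \<in> all_vertices \<T>" by simp
qed

lemma corner_vertices_lattice:
  assumes "v \<in> corner_vertices \<T>"
  shows "\<exists>m n. v = pt m n"
proof -
  have "v \<in> all_vertices \<T>"
    using assms unfolding corner_vertices_def all_vertices_def marked_points_def by blast
  then show ?thesis unfolding all_vertices_eq by blast
qed

lemma branch_vertices_eq:
  "branch_vertices \<T> = {v. \<exists>m n. v = pt m n \<and> 3 \<le> card {s \<in> segs. pt m n \<in> seg s}}"
  unfolding branch_vertices_def all_vertices_eq card_edges_at_lattice[symmetric] by blast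

text \<open>At a point where a horizontal and a vertical segment meet, the tile of the cell between
  them has a corner.\<close>

lemma corner_at:
  assumes "hE m n \<or> hE (m - 1) n" "vE m n \<or> vE m (n - 1)"
  shows "pt m n \<in> corner_vertices \<T>"
proof -
  \<comment> \<open>\<open>2 * m - 1 - k\<close> exchanges \<open>m - 1\<close> and
    \<open>m\<close>, so the chosen cell has neighbours of other tiles across both lines through the
    point.\<close>
  obtain k l where kl: "k \<in> {m - 1, m}" "l \<in> {n - 1, n}" "own k l \<noteq> own (2 * m - 1 - k) l"
      "own k l \<noteq> own k (2 * n - 1 - l)"
  proof -
    have "hE m n \<and> vE m n \<or> hE m n \<and> vE m (n - 1) \<or> hE (m - 1) n \<and> vE m n \<or> hE (m - 1) n \<and> vE m (n - 1)"
      using assms by blast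
    then show thesis
      using that[of m n] that[of m "n - 1"] that[of "m - 1" n] that[of "m - 1" "n - 1"]
      by (auto simp: hE_def vE_def)
  qed
  obtain p q s where o: "own k l = (p, q)" "owns p q s k l" by (rule ownE)
  then have pq: "(pt p q, s) \<in> tiles \<T>" "k \<in> {p - 1, p}" "l \<in> {q - 1, q}" "s \<noteq> quadrant_of p q k l"
    by (auto simp: owns_def)
  have notch_at: "s = quadrant_of p q i j" if "i \<in> {p - 1, p}" "j \<in> {q - 1, q}" "own i j \<noteq> (p, q)" for i j
    using that pq(1) unfolding own_iff owns_def by blast
  have "pt p q + pt (m - p) (n - q) \<in> corner_vertices \<T>"
  proof (rule in_corner_vertices[OF pq(1)])
    \<comment> \<open>The point is the reflex corner, a corner of the square around it, or the
      middle of a side of this square. In the last case a neighbouring cell lies in the square but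
      not in the tile, so it is the missing quarter and fixes \<open>s\<close>.\<close>
    consider "m = p" "n = q" | "m \<noteq> p" "n \<noteq> q" | "m \<noteq> p" "n = q" | "m = p" "n \<noteq> q" by blast
    then show "pt (m - p) (n - q) = 0 \<or> pt (m - p) (n - q) \<in> diag - {s} \<or>
        pt (m - p) (n - q) = Complex (Re s) 0 \<or> pt (m - p) (n - q) = Complex 0 (Im s)"
    proof cases
      case 1
      then show ?thesis by (simp add: complex_eq_iff)
    next
      case 2
      then have "pt (m - p) (n - q) = quadrant_of p q k l"
        using kl(1,2) pq(2,3) by (auto simp: quadrant_of_def complex_eq_iff)
      then show ?thesis using pq(4) by simp
    next
      case 3
      then have "s = quadrant_of p q k (2 * n - 1 - l)"
        using kl o(1) pq(2,3) by (intro notch_at) auto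
      then have "pt (m - p) (n - q) = Complex (Re s) 0"
        using 3 kl(1) pq(2) by (auto simp: quadrant_of_def complex_eq_iff)
      then show ?thesis by blast
    next
      case 4
      then have "s = quadrant_of p q (2 * m - 1 - k) l"
        using kl o(1) pq(2,3) by (intro notch_at) auto
      then have "pt (m - p) (n - q) = Complex 0 (Im s)"
        using 4 kl(2) pq(3) by (auto simp: quadrant_of_def complex_eq_iff)
      then show ?thesis by blast
    qed
  qed
  moreover have "pt p q + pt (m - p) (n - q) = pt m n"
    by (simp add: complex_eq_iff)
  ultimately show ?thesis by simp
qed

lemma chromatic_indices:
  "tiling_chromatic_index \<T> (all_vertices \<T>) = 4 \<and>
    tiling_chromatic_index \<T> (corner_vertices \<T>) = 4 \<and>
    tiling_chromatic_index \<T> (branch_vertices \<T>) = 4"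
proof (intro conjI)
  show "tiling_chromatic_index \<T> (corner_vertices \<T>) = 4"
    by (rule index_corner) (fact corner_vertices_lattice corner_at)+
qed (unfold all_vertices_eq branch_vertices_eq, fact index_all, fact index_branch)

end

theorem proposition3p1:
  fixes \<T> :: "complex set set"
  assumes "chair_tiling \<T>"
  shows "tiling_chromatic_index \<T> (all_vertices \<T>) = 4
    \<and> tiling_chromatic_index \<T> (corner_vertices \<T>) = 4
    \<and> tiling_chromatic_index \<T> (branch_vertices \<T>) = 4"
  using assms by (intro fixed_chair_tiling.chromatic_indices fixed_chair_tiling.intro)

end
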